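(* Let $A(t)=\int_0^t a(s)\,ds$ be a Young function satisfying $\int_{\mathbb{R}_+}A\left(\frac{k}{1+t}\right)dt<\infty$ for some $k>0$, and set $\mathcal A(t)=t\int_0^t a(s)\,\frac{ds}{s}$, $t>0$ (which is a Young function). Then there exists $C>0$, independent of locally integrable $f$ on $\mathbb{R}^n$, such that $$\rho_A(Mf)\le C\,\rho_{\mathcal A}(f).$$ Moreover, $L_{\mathcal A}(\mathbb{R}^n)$ is the largest Orlicz space mapped by $M$ into $L_A(\mathbb{R}^n)$; that is, if $B$ is a Young function such that $M$ maps $L_B(\mathbb{R}^n)$ into $L_A(\mathbb{R}^n)$, then $L_B(\mathbb{R}^n)\subset L_{\mathcal A}(\mathbb{R}^n)$.
   Context: $\mathbb{R}_+=(0,\infty)$. A Young function is a function $A(t)=\int_0^t a(s)\,ds$, $t\in\mathbb{R}_+$, where $a$ is a nondecreasing function mapping $\mathbb{R}_+$ onto itself. For a Young function $A$, the Luxemburg--Orlicz norm on $\mathbb{R}^n$ (Lebesgue measure) is $\rho_A(f)=\inf\{\lambda>0:\int_{\mathbb{R}^n}A(|f(x)|/\lambda)\,dx\le1\}$, with $\inf\emptyset=\infty$, and the Orlicz space $L_A(\mathbb{R}^n)$ consists of all measurable $f$ with $\int_{\mathbb{R}^n}A(|f(x)|/\lambda_f)\,dx<\infty$ for some $\lambda_f>0$, equivalently $\rho_A(f)<\infty$. For $f$ locally integrable on $\mathbb{R}^n$, the Hardy--Littlewood maximal function is $(Mf)(x)=\sup_{r>0}\frac{1}{|B(x,r)|}\int_{B(x,r)}|f(y)|\,dy$,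 where $B(x,r)=\{y\in\mathbb{R}^n:|x-y|<r\}$. *)

theory Defs
  imports "HOL-Analysis.Analysis"
begin

definition young_density :: "(real \<Rightarrow> real) \<Rightarrow> bool" where
  "young_density a \<longleftrightarrow> mono_on {0<..} a \<and> a ` {0<..} = {0<..}"

text \<open>
  Young functions are taken on \<open>[0, \<infinity>]\<close> instead of \<open>(0, \<infinity>)\<close>, so that they can be applied to a
  maximal function, which may vanish or be infinite. The same integral formula yields the
  limit values \<open>0\<close> at \<open>0\<close> and \<open>\<infinity>\<close> at \<open>\<infinity>\<close>. Values of \<open>a\<close> outside \<open>(0, \<infinity>)\<close> play no role.
\<close>

definition young_of :: "(real \<Rightarrow> real) \<Rightarrow> ennreal \<Rightarrow> ennreal" where
  "young_of a t = (\<integral>\<^sup>+s\<in>{s. 0 < s \<and> ennreal s < t}. ennreal (a s) \<partial>lborel)"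

definition young_function :: "(ennreal \<Rightarrow> ennreal) \<Rightarrow> bool" where
  "young_function A \<longleftrightarrow> (\<exists>a. young_density a \<and> A = young_of a)"

definition young_domain :: "(real \<Rightarrow> real) \<Rightarrow> ennreal \<Rightarrow> ennreal" where
  "young_domain a t = t * (\<integral>\<^sup>+s\<in>{s. 0 < s \<and> ennreal s < t}. ennreal (a s / s) \<partial>lborel)"

text \<open>
  Functions on Euclidean space are extended-real valued, so that \<open>f\<close> and its maximal function
  live in the same spaces. The infimum is taken in \<open>[0, \<infinity>]\<close>, where \<open>Inf {} = \<infinity>\<close>.
\<close>

definition luxemburg_norm :: "(ennreal \<Rightarrow> ennreal) \<Rightarrow> (real ^ 'n \<Rightarrow> ereal) \<Rightarrow> ennreal" where
  "luxemburg_norm A f =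
     Inf {ennreal l | l::real. 0 < l \<and> (\<integral>\<^sup>+x. A (e2ennreal \<bar>f x\<bar> / ennreal l) \<partial>lebesgue) \<le> 1}"

definition orlicz_space :: "(ennreal \<Rightarrow> ennreal) \<Rightarrow> (real ^ 'n \<Rightarrow> ereal) set" where
  "orlicz_space A = {f \<in> borel_measurable lebesgue.
     \<exists>l::real. 0 < l \<and> (\<integral>\<^sup>+x. A (e2ennreal \<bar>f x\<bar> / ennreal l) \<partial>lebesgue) < \<infinity>}"

definition locally_integrable :: "(real ^ 'n \<Rightarrow> ereal) \<Rightarrow> bool" where
  "locally_integrable f \<longleftrightarrow> f \<in> borel_measurable lebesgue \<and>
     (\<forall>K. compact K \<longrightarrow> (\<integral>\<^sup>+x\<in>K. e2ennreal \<bar>f x\<bar> \<partial>lebesgue) < \<infinity>)"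

definition hl_maximal :: "(real ^ 'n \<Rightarrow> ereal) \<Rightarrow> real ^ 'n \<Rightarrow> ereal" where
  "hl_maximal f x = enn2ereal (SUP r\<in>{0<..}.
     (\<integral>\<^sup>+y\<in>ball x r. e2ennreal \<bar>f y\<bar> \<partial>lebesgue) / emeasure lebesgue (ball x r))"

end

theory Submission
  imports Defs
begin

text \<open>
  Let \<open>n\<close> be the dimension. For a Young function with density \<open>a\<close>, Tonelli gives
  \<open>\<integral> A(Mf) = \<integral> a(s) |{Mf > s}| ds\<close> and \<open>\<integral> \<A>(f) = \<integral> (a(s) / s) (\<integral>\<^bsub>|f| > s\<^esub> |f|) ds\<close>. The two integrals are
  therefore comparable, up to dilations, as soon as \<open>s |{Mf > s}|\<close> and \<open>\<integral>\<^bsub>|f| > s\<^esub> |f|\<close> are.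
  One direction is the weak type inequality for \<open>f\<close> truncated at \<open>s / 2\<close>. For the other (Stein's
  converse), select by Vitali disjoint balls \<open>D\<close> on which the mean of \<open>|f|\<close> exceeds \<open>s\<close> while it
  is at most \<open>s\<close> on \<open>5D\<close>, such that the balls \<open>5D\<close> cover \<open>{Mf > s}\<close>; this set contains \<open>{|f| > s}\<close> up to
  a null set, and every \<open>D\<close> lies in \<open>{Mf > s / 2\<^sup>n}\<close>. Such balls exist for \<open>f\<close> in any Orlicz space,
  because the means of \<open>|f|\<close> over large balls are small. Thus \<open>f \<in> L\<^sub>B\<close> and \<open>Mf \<in> L\<^sub>A\<close> already
  imply \<open>f \<in> L\<^sub>\<A>\<close>, without a norm bound for \<open>M\<close>.
\<close>

section \<open>The maximal function\<close>

text \<open>Countable subadditivity on the left and additivity on the right carry a ball-by-ball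
  estimate to the unions. Allowing two measures lets \<open>density lebesgue F\<close> stand on
  either side, and allowing two families lets enlarged balls be compared with disjoint ones.\<close>

lemma emeasure_UN_le_of_disjoint:
  fixes B D :: "'i \<Rightarrow> 'a set"
  assumes C: "countable C" and B: "\<And>i. i \<in> C \<Longrightarrow> B i \<in> sets \<mu>" and D: "\<And>i. i \<in> C \<Longrightarrow> D i \<in> sets \<nu>"
    and disj: "disjoint_family_on B C"
    and le: "\<And>i. i \<in> C \<Longrightarrow> emeasure \<nu> (D i) \<le> c * emeasure \<mu> (B i)"
  shows "emeasure \<nu> (\<Union>i\<in>C. D i) \<le> c * emeasure \<mu> (\<Union>i\<in>C. B i)"
proof -
  \<comment> \<open>Re-indexing by natural numbers: \<open>X n\<close> is the set numbered n, or
    empty if n numbers nothing, so finite and infinite \<open>C\<close> are treated alike.\<close>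
  define g where "g = to_nat_on C"
  have g: "inj_on g C" using C by (simp add: g_def inj_on_to_nat_on)
  define X where "X n = (\<Union>i\<in>{i\<in>C. g i = n}. B i)" for n
  define Y where "Y n = (\<Union>i\<in>{i\<in>C. g i = n}. D i)" for n
  have single: "{i\<in>C. g i = n} = {} \<or> (\<exists>i\<in>C. {i\<in>C. g i = n} = {i})" for n
    using g by (fastforce simp: inj_on_def)
  have XY: "X n \<in> sets \<mu> \<and> Y n \<in> sets \<nu> \<and> emeasure \<nu> (Y n) \<le> c * emeasure \<mu> (X n)" for n
    using single[of n]
  proof (elim disjE bexE)
    assume eq: "{i\<in>C. g i = n} = {}"
    show ?thesis unfolding X_def Y_def eq by simp
  next
    fix i assume i: "i \<in> C" and eq: "{i\<in>C. g i = n} = {i}"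
    show ?thesis unfolding X_def Y_def eq using i B D le by simp
  qed
  have "disjoint_family X"
    using disj by (fastforce simp: disjoint_family_on_def X_def)
  have "emeasure \<nu> (\<Union>i\<in>C. D i) = emeasure \<nu> (\<Union>n. Y n)"
    by (rule arg_cong[of _ _ "emeasure \<nu>"]) (auto simp: Y_def)
  also have "\<dots> \<le> (\<Sum>n. emeasure \<nu> (Y n))"
    using XY by (intro emeasure_subadditive_countably) auto
  also have "\<dots> \<le> (\<Sum>n. c * emeasure \<mu> (X n))"
    using XY by (intro suminf_le) auto
  also have "\<dots> = c * emeasure \<mu> (\<Union>n. X n)"
    using XY \<open>disjoint_family X\<close> by (subst suminf_emeasure[symmetric]) auto
  also have "(\<Union>n. X n) = (\<Union>i\<in>C. B i)"
    by (auto simp: X_def)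
  finally show ?thesis .
qed

lemma emeasure_lebesgue_ball_scale:
  fixes x y :: "'a::euclidean_space"
  assumes "0 \<le> c" "0 \<le> r"
  shows "emeasure lebesgue (ball x (c * r)) = ennreal (c ^ DIM('a)) * emeasure lebesgue (ball y r)"
  using assms by (simp add: emeasure_ball power_mult_distrib ennreal_mult'[symmetric] mult_ac)

lemma emeasure_lborel_ball_pos:
  fixes x :: "'a::euclidean_space"
  assumes "0 < r"
  shows "0 < emeasure lborel (ball x r)" "emeasure lborel (ball x r) < top"
  using assms by (simp_all add: emeasure_ball)

lemma ennreal_less_divide_iff':
  fixes a b s :: ennreal
  assumes "0 < b" "b < top"
  shows "s < a / b \<longleftrightarrow> s * b < a"
proof -
  have "a / b \<le> s \<longleftrightarrow> a \<le> s * b"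
  proof
    assume "a / b \<le> s"
    then have "a / b * b \<le> s * b" by (rule mult_right_mono) simp
    then show "a \<le> s * b" using assms by (simp add: ennreal_divide_times)
  qed (use assms in \<open>auto intro!: divide_le_posI_ennreal simp: mult.commute\<close>)
  then show ?thesis by (simp add: not_le[symmetric])
qed

section \<open>The maximal function of a function with values in
  \<open>[0, \<infinity>]\<close>\<close>

definition maximal :: "('a::euclidean_space \<Rightarrow> ennreal) \<Rightarrow> 'a \<Rightarrow> ennreal" where
  "maximal F x = (SUP r\<in>{0<..}. (\<integral>\<^sup>+y\<in>ball x r. F y \<partial>lebesgue) / emeasure lebesgue (ball x r))"

lemma less_maximal_iff:
  "s < maximal F x \<longleftrightarrow>
    (\<exists>r>0. s * emeasure lebesgue (ball x r) < (\<integral>\<^sup>+y\<in>ball x r. F y \<partial>lebesgue))"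
  unfolding maximal_def less_SUP_iff
  by (intro bex_cong[THEN trans, OF refl ennreal_less_divide_iff'])
     (auto simp: emeasure_lborel_ball_pos)

text \<open>A mass strictly above s times the volume survives a slight shrinking of the ball, by
  continuity from below. The shrunken ball lies in the ball of the original radius around every
  nearby y, which has the same volume.\<close>

lemma open_less_maximal:
  assumes F[measurable]: "F \<in> borel_measurable lebesgue"
  shows "open {x. s < maximal F x}"
proof (rule openI)
  fix x assume "x \<in> {x. s < maximal F x}"
  then obtain r where r: "0 < r"
    and less: "s * emeasure lebesgue (ball x r) < (\<integral>\<^sup>+y\<in>ball x r. F y \<partial>lebesgue)"
    by (auto simp: less_maximal_iff)
  define R where "R n = r - r / real (Suc n)" for n
  have R_less: "R n < r" for n using r by (simp add: R_def)
  have un: "(\<Union>n. ball x (R n)) = ball x r"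
  proof (intro equalityI subsetI)
    fix y assume y: "y \<in> ball x r"
    have "(\<lambda>n. r - r * inverse (real (Suc n))) \<longlonglongrightarrow> r - r * 0"
      by (intro tendsto_intros LIMSEQ_inverse_real_of_nat)
    then have "\<forall>\<^sub>F n in sequentially. dist x y < R n"
      using y by (auto simp: R_def divide_inverse intro: order_tendstoD)
    then show "y \<in> (\<Union>n. ball x (R n))"
      by (auto simp: eventually_sequentially)
  qed (use R_less in \<open>auto intro: less_trans\<close>)
  have "incseq (\<lambda>n. ball x (R n))"
    unfolding incseq_def R_def using r
    by (intro allI impI subset_ball diff_left_mono divide_left_mono) auto
  then have "(SUP n. emeasure (density lebesgue F) (ball x (R n))) = emeasure (density lebesgue F) (ball x r)"
    by (subst SUP_emeasure_incseq) (auto simp: un)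
  with less have "s * emeasure lebesgue (ball x r) < (SUP n. emeasure (density lebesgue F) (ball x (R n)))"
    by (simp add: emeasure_density)
  then obtain n where n: "s * emeasure lebesgue (ball x r) < emeasure (density lebesgue F) (ball x (R n))"
    by (auto simp: less_SUP_iff)
  have "y \<in> {x. s < maximal F x}" if "y \<in> ball x (r - R n)" for y
  proof -
    have "ball x (R n) \<subseteq> ball y r"
      using that by (simp add: ball_subset_ball_iff dist_commute)
    then have "emeasure (density lebesgue F) (ball x (R n)) \<le> emeasure (density lebesgue F) (ball y r)"
      by (intro emeasure_mono) auto
    moreover have "emeasure lebesgue (ball x r) = emeasure lebesgue (ball y r)"
      using r by (simp add: emeasure_ball)
    ultimately show ?thesis
      using n r by (auto simp: less_maximal_iff emeasure_density intro!: exI[of _ r])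
  qed
  then show "\<exists>e>0. ball x e \<subseteq> {x. s < maximal F x}"
    using R_less[of n] by (intro exI[of _ "r - R n"]) auto
qed

lemma borel_measurable_maximal:
  assumes "F \<in> borel_measurable lebesgue"
  shows "maximal F \<in> borel_measurable lebesgue"
proof -
  have "maximal F \<in> borel_measurable borel"
    using open_less_maximal[OF assms] by (intro borel_measurableI_greater) (auto intro: borel_open)
  then show ?thesis by (simp add: measurable_completion)
qed

lemma integral_ball_le_maximal:
  assumes "0 < r"
  shows "(\<integral>\<^sup>+y\<in>ball x r. F y \<partial>lebesgue) \<le> maximal F x * emeasure lebesgue (ball x r)"
  using assms less_maximal_iff[of "maximal F x" F x] by (meson less_irrefl not_le)

text \<open>Vitali's covering lemma asks for bounded radii, while the averages bound
  volumes.\<close>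

lemma radius_le_of_emeasure_ball_le:
  assumes "K < top"
  obtains R where "\<And>(x::'a::euclidean_space) r. 0 < r \<Longrightarrow> emeasure lebesgue (ball x r) \<le> K \<Longrightarrow> r \<le> R"
proof -
  define v where "v = unit_ball_vol (DIM('a))"
  have v: "0 < v" by (simp add: v_def)
  obtain K' where K': "K = ennreal K'" "0 \<le> K'"
    using assms by (cases K) auto
  \<comment> \<open>For r > 1 one has r \<le> r^n, so a bound linear in K' does and no n-th root is
    taken.\<close>
  have "r \<le> max 1 (K' / v)" if r: "0 < r" and le: "emeasure lebesgue (ball x r) \<le> K" for x :: 'a and r
  proof (cases "r \<le> 1")
    case False
    then have "r ^ 1 \<le> r ^ DIM('a)"
      by (intro power_increasing) (auto simp: Suc_le_eq)
    moreover have "v * r ^ DIM('a) \<le> K'"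
      using le r K' by (simp add: emeasure_ball v_def)
    ultimately have "v * r \<le> K'"
      using v by (metis mult_left_mono less_imp_le order_trans power_one_right)
    then show ?thesis
      using v by (simp add: le_max_iff_disj field_simps)
  qed auto
  then show thesis using that by blast
qed

lemma nn_integral_le_truncation:
  fixes F :: "'a \<Rightarrow> ennreal"
  assumes [measurable]: "F \<in> borel_measurable M" "B \<in> sets M"
  shows "(\<integral>\<^sup>+y\<in>B. F y \<partial>M)
    \<le> (\<integral>\<^sup>+y\<in>B. F y * indicator {y. s < F y} y \<partial>M) + s * emeasure M B"
proof -
  have "(\<integral>\<^sup>+y\<in>B. F y \<partial>M)
    \<le> (\<integral>\<^sup>+y. F y * indicator {y. s < F y} y * indicator B y + s * indicator B y \<partial>M)"
    by (intro nn_integral_mono) (auto simp: indicator_def)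
  also have "\<dots> = (\<integral>\<^sup>+y\<in>B. F y * indicator {y. s < F y} y \<partial>M) + s * emeasure M B"
    by (subst nn_integral_add) (auto simp: nn_integral_cmult_indicator)
  finally show ?thesis .
qed

section \<open>The weak type inequality and its converse\<close>

text \<open>Values of F up to s/2 contribute at most s/2 to any mean, so a ball with mean above s
  has a mean of the truncation \<open>G\<close> of at least s/2. The factor 2 comes from the halved
  level, 5^n from Vitali's enlargement.\<close>

lemma maximal_weak_type:
  fixes F :: "'a::euclidean_space \<Rightarrow> ennreal"
  assumes F[measurable]: "F \<in> borel_measurable lebesgue" and s: "0 < s"
  shows "ennreal s * emeasure lebesgue {x. ennreal s < maximal F x}
    \<le> 2 * 5 ^ DIM('a) * (\<integral>\<^sup>+x\<in>{x. ennreal (s / 2) < F x}. F x \<partial>lebesgue)"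
proof -
  define G where "G x = F x * indicator {x. ennreal (s / 2) < F x} x" for x
  have G[measurable]: "G \<in> borel_measurable lebesgue" unfolding G_def by measurable
  let ?O = "{x. ennreal s < maximal F x}"
  have O[measurable]: "?O \<in> sets borel"
    using open_less_maximal[OF F] by (auto intro: borel_open)
  show ?thesis
  proof (cases "(\<integral>\<^sup>+x. G x \<partial>lebesgue) < top")
    case False
    then show ?thesis
      by (simp add: G_def not_less top_unique ennreal_mult_eq_top_iff ennreal_mult_top)
  next
    case True
    have half: "ennreal s = ennreal (s / 2) + ennreal (s / 2)"
      using s by (simp add: ennreal_plus[symmetric] del: ennreal_plus)
    have "\<exists>r>0. ennreal (s / 2) * emeasure lebesgue (ball x r) \<le> emeasure (density lebesgue G) (ball x r)"
      if x: "x \<in> ?O" for x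
    proof -
      obtain r where r: "0 < r"
        and less: "ennreal s * emeasure lebesgue (ball x r) < (\<integral>\<^sup>+y\<in>ball x r. F y \<partial>lebesgue)"
        using x by (auto simp: less_maximal_iff)
      have "(\<integral>\<^sup>+y\<in>ball x r. F y \<partial>lebesgue)
        \<le> emeasure (density lebesgue G) (ball x r) + ennreal (s / 2) * emeasure lebesgue (ball x r)"
        using nn_integral_le_truncation[OF F, of "ball x r" "ennreal (s / 2)"]
        by (simp add: emeasure_density G_def)
      \<comment> \<open>Were the mass of \<open>G\<close> at most s/2 times the volume, the two
        halves would add up to at most s times the volume.\<close>
      with less r show ?thesis
        unfolding half distrib_right by (intro exI[of _ r]) (meson add_right_mono leD le_cases order_trans)
    qed
    then obtain r where r: "\<And>x. x \<in> ?O \<Longrightarrow> 0 < r x"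
      and G_ge: "\<And>x. x \<in> ?O \<Longrightarrow> ennreal (s / 2) * emeasure lebesgue (ball x (r x))
        \<le> emeasure (density lebesgue G) (ball x (r x))"
      by metis
    have ball_le: "emeasure lebesgue (ball x (r x))
        \<le> ennreal (2 / s) * emeasure (density lebesgue G) (ball x (r x))" if x: "x \<in> ?O" for x
      using mult_left_mono[OF G_ge[OF x], of "ennreal (2 / s)"] s
      by (simp add: mult.assoc[symmetric] ennreal_mult[symmetric])
    have "emeasure (density lebesgue G) (ball x (r x)) \<le> (\<integral>\<^sup>+x. G x \<partial>lebesgue)" for x
      by (auto simp: emeasure_density indicator_def intro!: nn_integral_mono)
    then have le_K: "emeasure lebesgue (ball x (r x)) \<le> ennreal (2 / s) * (\<integral>\<^sup>+x. G x \<partial>lebesgue)"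
      if "x \<in> ?O" for x
      using ball_le[OF that] by (meson mult_left_mono order_trans zero_le)
    \<comment> \<open>Finiteness of the integral of \<open>G\<close> enters here: it bounds the
      volumes of the chosen balls, hence their radii.\<close>
    have "ennreal (2 / s) * (\<integral>\<^sup>+x. G x \<partial>lebesgue) < top"
      using True by (simp add: ennreal_mult_less_top)
    then obtain R where "\<And>(x::'a) r. 0 < r \<Longrightarrow>
        emeasure lebesgue (ball x r) \<le> ennreal (2 / s) * (\<integral>\<^sup>+x. G x \<partial>lebesgue) \<Longrightarrow> r \<le> R"
      using radius_le_of_emeasure_ball_le by blast
    then have R: "\<And>x. x \<in> ?O \<Longrightarrow> 0 < r x \<and> r x \<le> R"
      using r le_K by blast
    have cov: "?O \<subseteq> (\<Union>x\<in>?O. ball x (r x))" using r by force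
    obtain C
      where C: "countable C" "C \<subseteq> ?O" "pairwise (\<lambda>i j. disjnt (ball i (r i)) (ball j (r j))) C"
        and cover: "?O \<subseteq> (\<Union>i\<in>C. ball i (5 * r i))"
      by (rule Vitali_covering_lemma_balls[OF cov R])
    have "emeasure lebesgue ?O \<le> emeasure lebesgue (\<Union>i\<in>C. ball i (5 * r i))"
      using C(1) by (intro emeasure_mono[OF cover]) auto
    also have "\<dots> \<le> (ennreal (5 ^ DIM('a)) * ennreal (2 / s)) *
        emeasure (density lebesgue G) (\<Union>i\<in>C. ball i (r i))"
    proof (rule emeasure_UN_le_of_disjoint)
      show "disjoint_family_on (\<lambda>i. ball i (r i)) C"
        using C(3) by (auto simp: disjoint_family_on_def pairwise_def disjnt_def)
      fix i assume i: "i \<in> C"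
      then have "0 \<le> r i" using C(2) r by force
      then have "emeasure lebesgue (ball i (5 * r i)) = ennreal (5 ^ DIM('a)) * emeasure lebesgue (ball i (r i))"
        by (rule emeasure_lebesgue_ball_scale[rotated]) simp
      also have "\<dots> \<le> ennreal (5 ^ DIM('a)) * (ennreal (2 / s) * emeasure (density lebesgue G) (ball i (r i)))"
        using i C(2) by (intro mult_left_mono ball_le) auto
      finally show "emeasure lebesgue (ball i (5 * r i))
        \<le> ennreal (5 ^ DIM('a)) * ennreal (2 / s) * emeasure (density lebesgue G) (ball i (r i))"
        by (simp only: mult.assoc)
    qed (use C in auto)
    also have "\<dots> \<le> (ennreal (5 ^ DIM('a)) * ennreal (2 / s)) * (\<integral>\<^sup>+x. G x \<partial>lebesgue)"
      using C(1) by (intro mult_left_mono, subst emeasure_density)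
        (auto simp: indicator_def intro!: nn_integral_mono)
    finally have "ennreal s * emeasure lebesgue ?O
      \<le> ennreal s * (ennreal (5 ^ DIM('a)) * ennreal (2 / s) * (\<integral>\<^sup>+x. G x \<partial>lebesgue))"
      by (rule mult_left_mono) simp
    also have "\<dots> = ennreal (2 * 5 ^ DIM('a)) * (\<integral>\<^sup>+x. G x \<partial>lebesgue)"
      using s by (simp add: mult.assoc[symmetric] ennreal_mult[symmetric] mult.commute[of 2])
    also have "ennreal (2 * 5 ^ DIM('a)) = 2 * 5 ^ DIM('a)"
      using ennreal_power[of 5 "DIM('a)"] by (simp add: ennreal_mult)
    finally show ?thesis
      by (simp add: G_def)
  qed
qed

lemma maximal_reverse_weak_type:
  fixes F :: "'a::euclidean_space \<Rightarrow> ennreal"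
  assumes F[measurable]: "F \<in> borel_measurable lebesgue" and s: "0 < s"
    and large: "\<And>x r. R < r \<Longrightarrow> (\<integral>\<^sup>+y\<in>ball x r. F y \<partial>lebesgue) \<le> ennreal s * emeasure lebesgue (ball x r)"
  shows "(\<integral>\<^sup>+x\<in>{x. ennreal s < maximal F x}. F x \<partial>lebesgue)
    \<le> 5 ^ DIM('a) * (ennreal s * emeasure lebesgue {x. ennreal (s / 2 ^ DIM('a)) < maximal F x})"
proof -
  let ?O = "{x. ennreal s < maximal F x}"
  let ?U = "{x. ennreal (s / 2 ^ DIM('a)) < maximal F x}"
  have O[measurable]: "?O \<in> sets borel" "?U \<in> sets borel"
    using open_less_maximal[OF F] by (auto intro: borel_open)
  define good where "good x r \<longleftrightarrow>
      ennreal s * emeasure lebesgue (ball x r) < (\<integral>\<^sup>+y\<in>ball x r. F y \<partial>lebesgue)" for x r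
  have "\<exists>r>0. good x r \<and> \<not> good x (5 * r)" if x: "x \<in> ?O" for x
  proof (rule ccontr)
    assume contra: "\<not> ?thesis"
    obtain r where r: "0 < r" "good x r"
      using x by (auto simp: less_maximal_iff good_def)
    \<comment> \<open>If enlarging a good ball five times always gave a good ball, good radii would
      grow beyond \<open>R\<close>, against \<open>large\<close>.\<close>
    have all: "good x (5 ^ k * r)" for k
    proof (induction k)
      case (Suc k)
      have "0 < 5 ^ k * r" using r by simp
      with contra Suc have "good x (5 * (5 ^ k * r))" by blast
      then show ?case by (simp add: mult.assoc)
    qed (use r in simp)
    obtain k where "R / r < 5 ^ k"
      using real_arch_pow[of 5 "R / r"] by auto
    then have "R < 5 ^ k * r" using r by (simp add: field_simps)
    from large[OF this] all[of k] show False
      by (simp add: good_def not_le[symmetric])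
  qed
  then obtain r where r: "\<And>x. x \<in> ?O \<Longrightarrow> 0 < r x"
    and good: "\<And>x. x \<in> ?O \<Longrightarrow> good x (r x)" and bad: "\<And>x. x \<in> ?O \<Longrightarrow> \<not> good x (5 * r x)"
    by metis
  \<comment> \<open>No ball of radius above \<open>R\<close> is good, so \<open>large\<close> also
    supplies the bounded radii for Vitali's lemma.\<close>
  have R: "0 < r x \<and> r x \<le> R" if x: "x \<in> ?O" for x
    using r[OF x] good[OF x] large[of "r x" x] by (auto simp: good_def not_le[symmetric])
  have cov: "?O \<subseteq> (\<Union>x\<in>?O. ball x (r x))" using r by force
  obtain C
    where C: "countable C" "C \<subseteq> ?O" "pairwise (\<lambda>i j. disjnt (ball i (r i)) (ball j (r j))) C"
      and cover: "?O \<subseteq> (\<Union>i\<in>C. ball i (5 * r i))"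
    by (rule Vitali_covering_lemma_balls[OF cov R])
  have "(\<integral>\<^sup>+x\<in>?O. F x \<partial>lebesgue) = emeasure (density lebesgue F) ?O"
    by (simp add: emeasure_density)
  also have "\<dots> \<le> emeasure (density lebesgue F) (\<Union>i\<in>C. ball i (5 * r i))"
    using C(1) by (intro emeasure_mono[OF cover]) auto
  also have "\<dots> \<le> (5 ^ DIM('a) * ennreal s) * emeasure lebesgue (\<Union>i\<in>C. ball i (r i))"
  proof (rule emeasure_UN_le_of_disjoint)
    show "disjoint_family_on (\<lambda>i. ball i (r i)) C"
      using C(3) by (auto simp: disjoint_family_on_def pairwise_def disjnt_def)
    fix i assume i: "i \<in> C"
    then have "0 \<le> r i" using C(2) r by force
    then have scale: "emeasure lebesgue (ball i (5 * r i)) = ennreal (5 ^ DIM('a)) * emeasure lebesgue (ball i (r i))"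
      by (rule emeasure_lebesgue_ball_scale[rotated]) simp
    have "emeasure (density lebesgue F) (ball i (5 * r i)) \<le> ennreal s * emeasure lebesgue (ball i (5 * r i))"
      using bad[of i] i C(2) by (auto simp: good_def emeasure_density not_less)
    also have "\<dots> = 5 ^ DIM('a) * ennreal s * emeasure lebesgue (ball i (r i))"
      unfolding scale by (simp add: ennreal_power[symmetric] mult_ac)
    finally show "emeasure (density lebesgue F) (ball i (5 * r i))
        \<le> 5 ^ DIM('a) * ennreal s * emeasure lebesgue (ball i (r i))" .
  qed (use C in auto)
  also have "\<dots> \<le> (5 ^ DIM('a) * ennreal s) * emeasure lebesgue ?U"
  proof (intro mult_left_mono emeasure_mono subsetI)
    \<comment> \<open>The maximal function uses centred balls, so the ball around i is put into one
      of twice the radius around y. Its volume is 2^n times larger, whence the lowered level s /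
      2^n.\<close>
    fix y assume "y \<in> (\<Union>i\<in>C. ball i (r i))"
    then obtain i where i: "i \<in> ?O" "y \<in> ball i (r i)" using C(2) by blast
    then have ri: "0 < r i" using r by blast
    have sub: "ball i (r i) \<subseteq> ball y (2 * r i)"
      using i(2) by (simp add: ball_subset_ball_iff dist_commute)
    have "ennreal (s / 2 ^ DIM('a)) * emeasure lebesgue (ball y (2 * r i))
        = ennreal (s / 2 ^ DIM('a)) * (ennreal (2 ^ DIM('a)) * emeasure lebesgue (ball i (r i)))"
      using ri emeasure_lebesgue_ball_scale[of 2 "r i" y i] by simp
    also have "\<dots> = ennreal s * emeasure lebesgue (ball i (r i))"
      using s by (simp add: mult.assoc[symmetric] ennreal_mult[symmetric])
    also have "\<dots> < (\<integral>\<^sup>+y\<in>ball i (r i). F y \<partial>lebesgue)"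
      using good[OF i(1)] by (simp add: good_def)
    also have "\<dots> \<le> (\<integral>\<^sup>+z\<in>ball y (2 * r i). F z \<partial>lebesgue)"
      using sub by (intro nn_integral_mono) (auto simp: indicator_def)
    finally show "y \<in> ?U"
      using ri by (auto simp: less_maximal_iff intro!: exI[of _ "2 * r i"])
  qed auto
  finally show ?thesis by (simp only: mult.assoc)
qed

section \<open>Almost everywhere domination of a function by its maximal function\<close>

text \<open>
  If \<open>q \<le> F\<close> while all means of \<open>F\<close> over balls centred in \<open>E\<close> are at most \<open>p\<close>, then filling an open
  set slightly larger than \<open>E\<close> with disjoint balls centred in \<open>E\<close> yields \<open>q |E| \<le> p |E|\<close>. This
  replaces the Lebesgue differentiation theorem and needs no local integrability.
\<close>

lemma emeasure_maximal_gap_eq_0: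
  fixes F :: "'a::euclidean_space \<Rightarrow> ennreal" and p q :: ennreal
  assumes F[measurable]: "F \<in> borel_measurable lebesgue" and pq: "p < q" "q < top"
    and E: "E \<in> lmeasurable" and gap: "\<And>x. x \<in> E \<Longrightarrow> maximal F x \<le> p \<and> q \<le> F x"
  shows "emeasure lebesgue E = 0"
proof -
  have E_sets[measurable]: "E \<in> sets lebesgue" using E by auto
  obtain p' where p': "p = ennreal p'" "0 \<le> p'"
    using pq by (cases p) (auto simp: less_top[symmetric])
  have "emeasure (density lebesgue F) E \<le> p * emeasure lebesgue E + ennreal e" if e: "0 < e" for e
  proof -
    \<comment> \<open>The summand 1 keeps the quotient meaningful for p' = 0 and still gives p' d
      \<le> e.\<close>
    define d where "d = e / (p' + 1)"
    have d: "0 < d" "p' * d \<le> e" using e p' by (auto simp: d_def field_simps)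
    obtain T where T: "open T" "E \<subseteq> T" "(T - E) \<in> lmeasurable" "emeasure lebesgue (T - E) < ennreal d"
      using sets_lebesgue_outer_open[OF E_sets d(1)] by blast
    \<comment> \<open>Centres in \<open>E\<close> make the bound by p available, and inclusion in
      \<open>T\<close> limits the total volume of disjoint members. Arbitrarily small members make
      \<open>K\<close> a Vitali cover of \<open>E\<close>.\<close>
    define K where "K = {(x, r). x \<in> E \<and> 0 < r \<and> ball x r \<subseteq> T}"
    have fine: "\<exists>i. i \<in> K \<and> x \<in> ball (fst i) (snd i) \<and> snd i < \<delta>" if "x \<in> E" "0 < \<delta>" for x \<delta>
    proof -
      obtain r where "0 < r" "ball x r \<subseteq> T"
        using T(1,2) \<open>x \<in> E\<close> by (meson open_contains_ball subsetD)
      then have "(x, min r (\<delta> / 2)) \<in> K"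
        using that by (auto simp: K_def)
      then show ?thesis
        using that \<open>0 < r\<close> by (intro exI[of _ "(x, min r (\<delta> / 2))"]) auto
    qed
    obtain C where C: "countable C" "C \<subseteq> K"
      "pairwise (\<lambda>i j. disjnt (ball (fst i) (snd i)) (ball (fst j) (snd j))) C"
      and neg: "negligible (E - (\<Union>i\<in>C. ball (fst i) (snd i)))"
      using Vitali_covering_theorem_balls[OF fine] by blast
    let ?V = "\<Union>i\<in>C. ball (fst i) (snd i)"
    \<comment> \<open>The uncovered part stays null for \<open>density lebesgue F\<close> by
      absolute continuity, even if F is not locally integrable.\<close>
    have "E - ?V \<in> null_sets lebesgue"
      using neg by (simp add: negligible_iff_null_sets)
    then have null: "E - ?V \<in> null_sets (density lebesgue F)"
      by (rule absolutely_continuousI_density[OF F, unfolded absolutely_continuous_def, THEN subsetD])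
    have "emeasure (density lebesgue F) E \<le> emeasure (density lebesgue F) (?V \<union> (E - ?V))"
      using C(1) by (intro emeasure_mono) (auto intro!: sets.countable_UN')
    also have "\<dots> = emeasure (density lebesgue F) ?V"
      using C(1) null by (intro emeasure_Un_null_set) auto
    also have "\<dots> \<le> p * emeasure lebesgue ?V"
    proof (rule emeasure_UN_le_of_disjoint)
      show "disjoint_family_on (\<lambda>i. ball (fst i) (snd i)) C"
        using C(3) by (auto simp: disjoint_family_on_def pairwise_def disjnt_def)
      fix i assume "i \<in> C"
      then have i: "fst i \<in> E" "0 < snd i" using C(2) by (auto simp: K_def)
      have "emeasure (density lebesgue F) (ball (fst i) (snd i))
          \<le> maximal F (fst i) * emeasure lebesgue (ball (fst i) (snd i))"
        using integral_ball_le_maximal[OF i(2)] by (simp add: emeasure_density)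
      also have "\<dots> \<le> p * emeasure lebesgue (ball (fst i) (snd i))"
        using gap[OF i(1)] by (intro mult_right_mono) auto
      finally show "emeasure (density lebesgue F) (ball (fst i) (snd i))
          \<le> p * emeasure lebesgue (ball (fst i) (snd i))" .
    qed (use C in auto)
    also have "\<dots> \<le> p * emeasure lebesgue (E \<union> (T - E))"
    proof (intro mult_left_mono emeasure_mono)
      have "?V \<subseteq> T" using C(2) by (force simp: K_def)
      then show "?V \<subseteq> E \<union> (T - E)" by blast
      show "E \<union> (T - E) \<in> sets lebesgue" using T(3) by (intro sets.Un) auto
    qed simp
    also have "\<dots> \<le> p * (emeasure lebesgue E + emeasure lebesgue (T - E))"
      using T(1) by (intro mult_left_mono emeasure_subadditive) auto
    also have "\<dots> \<le> p * (emeasure lebesgue E + ennreal d)"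
      using T(4) by (intro mult_left_mono add_left_mono) auto
    also have "\<dots> \<le> p * emeasure lebesgue E + ennreal e"
      unfolding distrib_left using d p'
      by (intro add_left_mono) (simp add: ennreal_mult[symmetric] ennreal_leI)
    finally show ?thesis .
  qed
  then have "emeasure (density lebesgue F) E \<le> p * emeasure lebesgue E"
    by (rule ennreal_le_epsilon)
  moreover have "q * emeasure lebesgue E \<le> emeasure (density lebesgue F) E"
  proof -
    have "q * emeasure lebesgue E = (\<integral>\<^sup>+x. q * indicator E x \<partial>lebesgue)"
      by (rule nn_integral_cmult_indicator[OF E_sets, symmetric])
    also have "\<dots> \<le> (\<integral>\<^sup>+x\<in>E. F x \<partial>lebesgue)"
      using gap by (intro nn_integral_mono) (auto simp: indicator_def)
    also have "\<dots> = emeasure (density lebesgue F) E"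
      by (rule emeasure_density[OF F E_sets, symmetric])
    finally show ?thesis .
  qed
  ultimately have le: "q * emeasure lebesgue E \<le> p * emeasure lebesgue E"
    by simp
  \<comment> \<open>Since \<open>E\<close> has finite measure, the inequality can be read in the
    reals, where p' < q' forces m = 0.\<close>
  obtain m where m: "emeasure lebesgue E = ennreal m" "0 \<le> m"
    using fmeasurableD2[OF E] by (cases "emeasure lebesgue E") auto
  obtain q' where q': "q = ennreal q'" "0 \<le> q'"
    using pq by (cases q) auto
  have "q' * m \<le> p' * m"
    using le p' q' m by (simp add: ennreal_mult[symmetric])
  moreover have "p' < q'" using pq p' q' by (simp add: ennreal_less_iff)
  ultimately have "m = 0" using m(2) by (simp add: mult_le_cancel_right)
  then show ?thesis using m by simp
qed

text \<open>The exceptional set is a countable union of sets on which two rationals separate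
  \<open>maximal F\<close> from F. Intersecting with balls makes their measures finite, as
  \<open>emeasure_maximal_gap_eq_0\<close> requires.\<close>

lemma AE_le_maximal:
  fixes F :: "'a::euclidean_space \<Rightarrow> ennreal"
  assumes F[measurable]: "F \<in> borel_measurable lebesgue"
  shows "AE x in lebesgue. F x \<le> maximal F x"
proof -
  have [measurable]: "maximal F \<in> borel_measurable lebesgue"
    by (rule borel_measurable_maximal[OF F])
  define E where "E p q N = {x. maximal F x \<le> ennreal (real_of_rat p) \<and> ennreal (real_of_rat q) \<le> F x}
      \<inter> ball 0 (real N)" for p q :: rat and N :: nat
  have E: "E p q N \<in> lmeasurable" for p q N
  proof (rule bounded_set_imp_lmeasurable)
    have "{x \<in> space lebesgue. maximal F x \<le> ennreal (real_of_rat p) \<and> ennreal (real_of_rat q) \<le> F x}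
        \<in> sets lebesgue"
      by measurable
    moreover have "E p q N = {x \<in> space lebesgue. maximal F x \<le> ennreal (real_of_rat p) \<and> ennreal (real_of_rat q) \<le> F x}
        \<inter> ball 0 (real N)"
      by (simp add: E_def)
    moreover have "ball 0 (real N) \<in> sets (lebesgue :: 'a measure)" by simp
    ultimately show "E p q N \<in> sets lebesgue" by (simp only: sets.Int)
    show "bounded (E p q N)" unfolding E_def by (rule bounded_subset[OF bounded_ball Int_lower2])
  qed
  \<comment> \<open>The rationals are compared after \<open>ennreal\<close>, which sends negative
    ones to 0; p < q alone would not guarantee a gap.\<close>
  have "AE x in lebesgue. \<forall>p q N. ennreal (real_of_rat p) < ennreal (real_of_rat q) \<longrightarrow> x \<notin> E p q N"
  proof (intro AE_all_countable[THEN iffD2] allI)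
    fix p q N
    show "AE x in lebesgue. ennreal (real_of_rat p) < ennreal (real_of_rat q) \<longrightarrow> x \<notin> E p q N"
    proof (cases "ennreal (real_of_rat p) < ennreal (real_of_rat q)")
      case True
      have "emeasure lebesgue (E p q N) = 0"
        by (rule emeasure_maximal_gap_eq_0[OF F True _ E]) (auto simp: E_def)
      then have "AE x in lebesgue. x \<notin> E p q N"
        using fmeasurableD[OF E] by (intro AE_not_in null_setsI)
      then show ?thesis by auto
    qed auto
  qed
  then show ?thesis
  proof eventually_elim
    case x: (elim x)
    show ?case
    proof (rule ccontr)
      assume "\<not> F x \<le> maximal F x"
      then obtain q where q: "maximal F x < ennreal (real_of_rat q)" "ennreal (real_of_rat q) < F x"
        using ennreal_rat_dense[of "maximal F x" "F x"] by (auto simp: not_le)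
      obtain p where p: "maximal F x < ennreal (real_of_rat p)" "ennreal (real_of_rat p) < ennreal (real_of_rat q)"
        using ennreal_rat_dense[OF q(1)] by auto
      obtain N :: nat where "norm x < real N" using reals_Archimedean2 by blast
      then have "x \<in> E p q N" using p q by (simp add: E_def less_imp_le)
      with x p(2) show False by simp
    qed
  qed
qed

section \<open>Modular inequalities\<close>

lemma sigma_finite_lebesgue: "sigma_finite_measure (lebesgue :: 'a::euclidean_space measure)"
proof
  show "\<exists>A::'a set set. countable A \<and> A \<subseteq> sets lebesgue \<and> \<Union> A = space lebesgue \<and> (\<forall>a\<in>A. emeasure lebesgue a \<noteq> \<infinity>)"
  proof (intro exI conjI ballI)
    show "\<Union> (range (\<lambda>n. ball 0 (real n))) = space (lebesgue :: 'a measure)"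
      using reals_Archimedean2 by auto
    show "emeasure lebesgue a \<noteq> \<infinity>" if "a \<in> range (\<lambda>n. ball (0::'a) (real n))" for a
      using that by (auto simp: emeasure_ball)
  qed auto
qed

text \<open>Tonelli for h(s) w(x) on the region 0 < s < G(x). Weight 1 gives the distribution
  function formula for \<open>young_of\<close>, weight G the formula for
  \<open>young_domain\<close>.\<close>

lemma nn_integral_layer_cake:
  fixes h :: "real \<Rightarrow> ennreal" and G w :: "'a \<Rightarrow> ennreal"
  assumes M: "sigma_finite_measure M"
    and [measurable]: "h \<in> borel_measurable borel" "G \<in> borel_measurable M" "w \<in> borel_measurable M"
  shows "(\<integral>\<^sup>+x. w x * (\<integral>\<^sup>+s\<in>{s. 0 < s \<and> ennreal s < G x}. h s \<partial>lborel) \<partial>M)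
    = (\<integral>\<^sup>+s\<in>{0<..}. h s * (\<integral>\<^sup>+x\<in>{x. ennreal s < G x}. w x \<partial>M) \<partial>lborel)"
proof -
  interpret M: sigma_finite_measure M by (rule M)
  interpret pair_sigma_finite lborel M ..
  define k where "k s x = h s * indicator {0<..} s * (w x * indicator {x. ennreal s < G x} x)" for s x
  have k[measurable]: "case_prod k \<in> borel_measurable (lborel \<Otimes>\<^sub>M M)"
    unfolding k_def indicator_def by measurable
  have "w x * (\<integral>\<^sup>+s\<in>{s. 0 < s \<and> ennreal s < G x}. h s \<partial>lborel) = (\<integral>\<^sup>+s. k s x \<partial>lborel)" for x
    unfolding k_def by (subst nn_integral_cmult[symmetric]) (auto intro!: nn_integral_cong simp: indicator_def mult.commute)
  then have "(\<integral>\<^sup>+x. w x * (\<integral>\<^sup>+s\<in>{s. 0 < s \<and> ennreal s < G x}. h s \<partial>lborel) \<partial>M)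
      = (\<integral>\<^sup>+x. \<integral>\<^sup>+s. k s x \<partial>lborel \<partial>M)"
    by simp
  also have "\<dots> = (\<integral>\<^sup>+s. \<integral>\<^sup>+x. k s x \<partial>M \<partial>lborel)"
    by (rule Fubini'[OF k])
  also have "\<dots> = (\<integral>\<^sup>+s\<in>{0<..}. h s * (\<integral>\<^sup>+x\<in>{x. ennreal s < G x}. w x \<partial>M) \<partial>lborel)"
    unfolding k_def by (intro nn_integral_cong) (subst nn_integral_cmult, auto simp: mult_ac)
  finally show ?thesis .
qed

lemma divide_ennreal_eq_mult:
  assumes "0 < l" shows "x / ennreal l = ennreal (1 / l) * x"
  using assms by (simp add: divide_ennreal_def inverse_ennreal inverse_eq_divide mult.commute)

lemma ennreal_less_divide_ennreal_iff:
  assumes "0 < l" "0 \<le> s"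
  shows "ennreal s < x / ennreal l \<longleftrightarrow> ennreal (s * l) < x"
  using assms by (simp add: ennreal_less_divide_iff' ennreal_mult)

lemma nn_integral_young_of:
  assumes M: "sigma_finite_measure M"
    and [measurable]: "a \<in> borel_measurable borel" "G \<in> borel_measurable M"
  shows "(\<integral>\<^sup>+x. young_of a (G x) \<partial>M)
    = (\<integral>\<^sup>+s\<in>{0<..}. ennreal (a s) * emeasure M {x\<in>space M. ennreal s < G x} \<partial>lborel)"
proof -
  have em: "(\<integral>\<^sup>+x. indicator {x. ennreal s < G x} x \<partial>M) = emeasure M {x\<in>space M. ennreal s < G x}" for s
  proof -
    have "(\<integral>\<^sup>+x. indicator {x. ennreal s < G x} x \<partial>M) = (\<integral>\<^sup>+x. indicator {x\<in>space M. ennreal s < G x} x \<partial>M)"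
      by (intro nn_integral_cong) (auto simp: indicator_def)
    also have "\<dots> = emeasure M {x\<in>space M. ennreal s < G x}"
      by (rule nn_integral_indicator) measurable
    finally show ?thesis .
  qed
  show ?thesis
    unfolding em[symmetric] young_of_def
    using nn_integral_layer_cake[OF M, of "\<lambda>s. ennreal (a s)" G "\<lambda>_. 1"] by (simp only: mult_1_left) simp
qed

lemma nn_integral_young_domain:
  assumes M: "sigma_finite_measure M"
    and [measurable]: "a \<in> borel_measurable borel" "G \<in> borel_measurable M"
  shows "(\<integral>\<^sup>+x. young_domain a (G x) \<partial>M)
    = (\<integral>\<^sup>+s\<in>{0<..}. ennreal (a s / s) * (\<integral>\<^sup>+x\<in>{x. ennreal s < G x}. G x \<partial>M) \<partial>lborel)"
  unfolding young_domain_def by (rule nn_integral_layer_cake[OF M]) measurable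

section \<open>Comparison of the two modulars\<close>

text \<open>The layer-cake integrands are compared at each s. Dilation by 2 l calls for the weak
  type inequality at level 2 l s, whose truncation at half the level is exactly
  \<open>F / l > s\<close>.\<close>

lemma nn_integral_young_of_maximal_le:
  fixes F :: "'a::euclidean_space \<Rightarrow> ennreal"
  assumes a[measurable]: "a \<in> borel_measurable borel" and F[measurable]: "F \<in> borel_measurable lebesgue"
    and l: "0 < l"
  shows "(\<integral>\<^sup>+x. young_of a (maximal F x / ennreal (2 * l)) \<partial>lebesgue)
    \<le> 5 ^ DIM('a) * (\<integral>\<^sup>+x. young_domain a (F x / ennreal l) \<partial>lebesgue)"
proof -
  note [measurable] = borel_measurable_maximal[OF F]
  let ?m = "\<lambda>s. emeasure lebesgue {x. ennreal s < maximal F x / ennreal (2 * l)}"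
  let ?J = "\<lambda>s. \<integral>\<^sup>+x\<in>{x. ennreal s < F x / ennreal l}. F x / ennreal l \<partial>lebesgue"
  have key: "ennreal (a s) * ?m s \<le> 5 ^ DIM('a) * (ennreal (a s / s) * ?J s)" if s: "0 < s" for s
  proof -
    have J: "?J s = ennreal (1 / l) * (\<integral>\<^sup>+x\<in>{x. ennreal (s * l) < F x}. F x \<partial>lebesgue)"
      unfolding ennreal_less_divide_ennreal_iff[OF l less_imp_le[OF s]]
      unfolding divide_ennreal_eq_mult[OF l] mult.assoc
      by (rule nn_integral_cmult) measurable
    have m: "?m s = emeasure lebesgue {x. ennreal (s * (2 * l)) < maximal F x}"
      using l s by (simp add: ennreal_less_divide_ennreal_iff)
    have sl: "0 < s * (2 * l)" "s * (2 * l) / 2 = s * l" using l s by auto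
    have "ennreal (s * (2 * l)) * ?m s \<le> 2 * 5 ^ DIM('a) * (\<integral>\<^sup>+x\<in>{x. ennreal (s * l) < F x}. F x \<partial>lebesgue)"
      unfolding m using maximal_weak_type[OF F sl(1)] unfolding sl(2) .
    \<comment> \<open>This factor leaves the weight a(s) on the left. On the right the 2 of the weak
      type constant cancels the 2 of the dilation, leaving a(s)/s and 1/l.\<close>
    then have "ennreal (a s / (s * (2 * l))) * (ennreal (s * (2 * l)) * ?m s)
        \<le> ennreal (a s / (s * (2 * l))) * (2 * 5 ^ DIM('a) * (\<integral>\<^sup>+x\<in>{x. ennreal (s * l) < F x}. F x \<partial>lebesgue))"
      by (rule mult_left_mono) simp
    also have "ennreal (a s / (s * (2 * l))) * (ennreal (s * (2 * l)) * ?m s) = ennreal (a s) * ?m s"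
    proof -
      have "ennreal (a s / (s * (2 * l))) * ennreal (s * (2 * l)) = ennreal (a s)"
        using l s by (subst ennreal_mult''[symmetric]) auto
      then show ?thesis by (simp only: mult.assoc[symmetric])
    qed
    also have "ennreal (a s / (s * (2 * l))) * (2 * 5 ^ DIM('a) * (\<integral>\<^sup>+x\<in>{x. ennreal (s * l) < F x}. F x \<partial>lebesgue))
      = 5 ^ DIM('a) * ((ennreal (a s / (s * (2 * l))) * 2) * (\<integral>\<^sup>+x\<in>{x. ennreal (s * l) < F x}. F x \<partial>lebesgue))"
      by (simp only: mult_ac)
    also have "ennreal (a s / (s * (2 * l))) * 2 = ennreal (a s / s) * ennreal (1 / l)"
      using l s by (subst ennreal_numeral[symmetric], subst (1 2) ennreal_mult''[symmetric]) auto
    finally show ?thesis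
      unfolding J by (simp only: mult.assoc)
  qed
  have "(\<integral>\<^sup>+x. young_of a (maximal F x / ennreal (2 * l)) \<partial>lebesgue)
      = (\<integral>\<^sup>+s\<in>{0<..}. ennreal (a s) * ?m s \<partial>lborel)"
    by (subst nn_integral_young_of[OF sigma_finite_lebesgue]) (simp_all add: divide_ennreal_def)
  also have "\<dots> \<le> (\<integral>\<^sup>+s. 5 ^ DIM('a) * (ennreal (a s / s) * ?J s * indicator {0<..} s) \<partial>lborel)"
    using key by (intro nn_integral_mono) (auto simp: indicator_def)
  also have "\<dots> = 5 ^ DIM('a) * (\<integral>\<^sup>+s\<in>{0<..}. ennreal (a s / s) * ?J s \<partial>lborel)"
  proof (rule nn_integral_cmult)
    interpret L: sigma_finite_measure "lebesgue :: 'a measure" by (rule sigma_finite_lebesgue)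
    have [measurable]: "?J \<in> borel_measurable borel"
      unfolding indicator_def divide_ennreal_def by measurable
    show "(\<lambda>s. ennreal (a s / s) * ?J s * indicator {0<..} s) \<in> borel_measurable lborel"
      by measurable
  qed
  also have "\<dots> = 5 ^ DIM('a) * (\<integral>\<^sup>+x. young_domain a (F x / ennreal l) \<partial>lebesgue)"
    by (subst nn_integral_young_domain[OF sigma_finite_lebesgue]) (simp_all add: divide_ennreal_def)
  finally show ?thesis .
qed

text \<open>The same comparison in reverse: the dilation 2^n l makes up for the level lowered by 2^n
  in the converse weak type inequality. As all levels s occur, \<open>large\<close> is assumed for
  each of them, with \<open>R\<close> depending on s.\<close>

lemma nn_integral_young_domain_le_maximal:
  fixes F :: "'a::euclidean_space \<Rightarrow> ennreal"
  assumes a[measurable]: "a \<in> borel_measurable borel" and F[measurable]: "F \<in> borel_measurable lebesgue"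
    and l: "0 < l"
    and large: "\<And>s. 0 < s \<Longrightarrow> \<exists>R. \<forall>x r. R < r \<longrightarrow>
      (\<integral>\<^sup>+y\<in>ball x r. F y \<partial>lebesgue) \<le> ennreal s * emeasure lebesgue (ball x r)"
  shows "(\<integral>\<^sup>+x. young_domain a (F x / ennreal (2 ^ DIM('a) * l)) \<partial>lebesgue)
    \<le> 5 ^ DIM('a) * (\<integral>\<^sup>+x. young_of a (maximal F x / ennreal l) \<partial>lebesgue)"
proof -
  note [measurable] = borel_measurable_maximal[OF F]
  define l' where "l' = 2 ^ DIM('a) * l"
  have l': "0 < l'" using l by (simp add: l'_def)
  let ?m = "\<lambda>s. emeasure lebesgue {x. ennreal s < maximal F x / ennreal l}"
  let ?J = "\<lambda>s. \<integral>\<^sup>+x\<in>{x. ennreal s < F x / ennreal l'}. F x / ennreal l' \<partial>lebesgue"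
  have key: "ennreal (a s / s) * ?J s \<le> 5 ^ DIM('a) * (ennreal (a s) * ?m s)" if s: "0 < s" for s
  proof -
    have J: "?J s = ennreal (1 / l') * (\<integral>\<^sup>+x\<in>{x. ennreal (s * l') < F x}. F x \<partial>lebesgue)"
      unfolding ennreal_less_divide_ennreal_iff[OF l' less_imp_le[OF s]]
      unfolding divide_ennreal_eq_mult[OF l'] mult.assoc
      by (rule nn_integral_cmult) measurable
    have sl: "0 < s * l'" "s * l' / 2 ^ DIM('a) = s * l" using l' s by (auto simp: l'_def)
    have m: "?m s = emeasure lebesgue {x. ennreal (s * l' / 2 ^ DIM('a)) < maximal F x}"
      unfolding sl(2) using l s by (simp add: ennreal_less_divide_ennreal_iff)
    obtain R where R: "\<And>x r. R < r \<Longrightarrow>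
        (\<integral>\<^sup>+y\<in>ball x r. F y \<partial>lebesgue) \<le> ennreal (s * l') * emeasure lebesgue (ball x r)"
      using large[OF sl(1)] by blast
    have "(\<integral>\<^sup>+x\<in>{x. ennreal (s * l') < F x}. F x \<partial>lebesgue)
        \<le> (\<integral>\<^sup>+x\<in>{x. ennreal (s * l') < maximal F x}. F x \<partial>lebesgue)"
      using AE_le_maximal[OF F]
      by (intro nn_integral_mono_AE, eventually_elim) (auto simp: indicator_def)
    also have "\<dots> \<le> 5 ^ DIM('a) * (ennreal (s * l') * ?m s)"
      unfolding m by (rule maximal_reverse_weak_type[OF F sl(1) R])
    finally have "ennreal (a s / s) * ?J s
        \<le> ennreal (a s / s) * (ennreal (1 / l') * (5 ^ DIM('a) * (ennreal (s * l') * ?m s)))"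
      unfolding J by (intro mult_left_mono) auto
    also have "\<dots> = 5 ^ DIM('a) * (ennreal (a s / s) * ennreal (1 / l') * ennreal (s * l') * ?m s)"
      by (simp only: mult_ac)
    also have "ennreal (a s / s) * ennreal (1 / l') * ennreal (s * l') = ennreal (a s)"
      using l' s by (simp add: ennreal_mult''[symmetric])
    finally show ?thesis .
  qed
  have "(\<integral>\<^sup>+x. young_domain a (F x / ennreal l') \<partial>lebesgue)
      = (\<integral>\<^sup>+s\<in>{0<..}. ennreal (a s / s) * ?J s \<partial>lborel)"
    by (subst nn_integral_young_domain[OF sigma_finite_lebesgue]) (simp_all add: divide_ennreal_def)
  also have "\<dots> \<le> (\<integral>\<^sup>+s. 5 ^ DIM('a) * (ennreal (a s) * ?m s * indicator {0<..} s) \<partial>lborel)"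
    using key by (intro nn_integral_mono) (auto simp: indicator_def)
  also have "\<dots> = 5 ^ DIM('a) * (\<integral>\<^sup>+s\<in>{0<..}. ennreal (a s) * ?m s \<partial>lborel)"
  proof (rule nn_integral_cmult)
    interpret L: sigma_finite_measure "lebesgue :: 'a measure" by (rule sigma_finite_lebesgue)
    \<comment> \<open>As the integral of an indicator, the distribution function is measurable in s
      by the rule for parametrised integrals.\<close>
    have "?m s = (\<integral>\<^sup>+x. indicator {x. ennreal s < maximal F x / ennreal l} x \<partial>lebesgue)" for s
    proof (rule nn_integral_indicator[symmetric])
      have "{x \<in> space lebesgue. ennreal s < maximal F x / ennreal l} \<in> sets lebesgue"
        unfolding divide_ennreal_def by measurable
      then show "{x. ennreal s < maximal F x / ennreal l} \<in> sets lebesgue" by simp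
    qed
    moreover have "(\<lambda>s. \<integral>\<^sup>+x. indicator {x. ennreal s < maximal F x / ennreal l} x \<partial>lebesgue)
        \<in> borel_measurable borel"
      unfolding indicator_def divide_ennreal_def by measurable
    ultimately have [measurable]: "?m \<in> borel_measurable borel" by simp
    show "(\<lambda>s. ennreal (a s) * ?m s * indicator {0<..} s) \<in> borel_measurable lborel"
      by measurable
  qed
  also have "(\<integral>\<^sup>+s\<in>{0<..}. ennreal (a s) * ?m s \<partial>lborel)
      = (\<integral>\<^sup>+x. young_of a (maximal F x / ennreal l) \<partial>lebesgue)"
    by (subst nn_integral_young_of[OF sigma_finite_lebesgue]) (simp_all add: divide_ennreal_def)
  finally show ?thesis by (simp only: l'_def)
qed

section \<open>Linear lower bounds for Young functions and means over large balls\<close>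

lemma emeasure_lborel_greater_ennreal_less:
  assumes "0 \<le> u"
  shows "emeasure lborel {s. u < s \<and> ennreal s < t} = t - ennreal u"
proof (cases t)
  case (real v)
  then have "{s. u < s \<and> ennreal s < t} = (if u < v then {u<..<v} else {})"
    using assms by (auto simp: ennreal_less_iff)
  then show ?thesis using real assms by (auto simp: ennreal_minus ennreal_neg)
next
  case top
  have "emeasure lborel {u<..} = (\<infinity> :: ennreal)"
  proof (rule ccontr)
    assume "emeasure lborel {u<..} \<noteq> (\<infinity> :: ennreal)"
    then obtain m where m: "emeasure lborel {u<..} = ennreal m" "0 \<le> m"
      by (cases "emeasure lborel {u<..}") auto
    have "emeasure lborel {u<..<u + m + 1} \<le> emeasure lborel {u<..}"
      by (intro emeasure_mono) auto
    then show False using m by (simp del: ennreal_plus)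
  qed
  moreover have "{s. u < s \<and> ennreal s < t} = {u<..}" using top by auto
  ultimately show ?thesis using top by simp
qed

text \<open>Keep the part of the integral over (c/2, t): there b is at least b(c/2), and t > c makes
  the length at least t/2.\<close>

lemma young_of_ge_linear:
  assumes b: "young_density b" and c: "0 < c" and t: "ennreal c < t"
  shows "ennreal (b (c / 2) / 2) * t \<le> young_of b t"
proof -
  have b_mono: "b (c / 2) \<le> b s" if "c / 2 < s" for s
    using b c that by (auto simp: young_density_def mono_on_def)
  have "t / 2 \<le> t - ennreal (c / 2)"
  proof (cases t)
    case (real v)
    then have "c < v" using t c by (simp add: ennreal_less_iff)
    then have "ennreal (v / 2) \<le> ennreal (v - c / 2)"
      by (intro ennreal_leI) simp
    then show ?thesis
      using real c by (simp add: ennreal_minus ennreal_divide_numeral)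
  qed simp
  then have "ennreal (b (c / 2)) * (t / 2) \<le> ennreal (b (c / 2)) * emeasure lborel {s. c / 2 < s \<and> ennreal s < t}"
    using c by (subst emeasure_lborel_greater_ennreal_less) (auto intro: mult_left_mono)
  also have "\<dots> = (\<integral>\<^sup>+s. ennreal (b (c / 2)) * indicator {s. c / 2 < s \<and> ennreal s < t} s \<partial>lborel)"
    by (subst nn_integral_cmult_indicator) auto
  also have "\<dots> \<le> young_of b t"
    unfolding young_of_def using c b_mono
    by (intro nn_integral_mono) (auto simp: indicator_def intro: ennreal_leI)
  also have "ennreal (b (c / 2)) * (t / 2) = ennreal (b (c / 2) / 2) * t"
    by (cases "0 \<le> b (c / 2)") (simp_all add: ennreal_divide_numeral[symmetric] ennreal_times_divide ennreal_neg divide_ennreal_def mult_ac)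
  finally show ?thesis .
qed

text \<open>By the linear lower bound the part of F above s/2 is integrable, so its mean is at most
  s/2 over balls of large volume. The remaining part contributes at most s/2 to any mean.\<close>

lemma ball_averages_small_of_young_of:
  fixes F :: "'a::euclidean_space \<Rightarrow> ennreal"
  assumes b: "young_density b" and F[measurable]: "F \<in> borel_measurable lebesgue" and l: "0 < l"
    and fin: "(\<integral>\<^sup>+x. young_of b (F x / ennreal l) \<partial>lebesgue) < \<infinity>" and s: "0 < s"
  shows "\<exists>R. \<forall>x r. R < r \<longrightarrow>
      (\<integral>\<^sup>+y\<in>ball x r. F y \<partial>lebesgue) \<le> ennreal s * emeasure lebesgue (ball x r)"
proof -
  let ?G = "\<lambda>y. F y * indicator {y. ennreal (s / 2) < F y} y"
  \<comment> \<open>\<open>c\<close> is the level s/2 seen after division by \<open>l\<close>;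
    \<open>d\<close> is the slope from \<open>young_of_ge_linear\<close>, rescaled to F.\<close>
  define c where "c = s / (2 * l)"
  have c: "0 < c" "c * l = s / 2" using s l by (auto simp: c_def)
  define d where "d = b (c / 2) / (2 * l)"
  have "0 < b (c / 2)" using b c by (auto simp: young_density_def)
  then have d: "0 < d" using l by (simp add: d_def)
  have "ennreal d * ?G y \<le> young_of b (F y / ennreal l)" for y
  proof (cases "ennreal (s / 2) < F y")
    case True
    then have "ennreal c < F y / ennreal l"
      using c(1) l by (simp only: ennreal_less_divide_ennreal_iff c(2) less_imp_le)
    from young_of_ge_linear[OF b c(1) this] show ?thesis
      using True l \<open>0 < b (c / 2)\<close>
      by (simp add: divide_ennreal_eq_mult mult.assoc[symmetric] ennreal_mult[symmetric] d_def)
  qed simp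
  then have "(\<integral>\<^sup>+y. ennreal d * ?G y \<partial>lebesgue) \<le> (\<integral>\<^sup>+y. young_of b (F y / ennreal l) \<partial>lebesgue)"
    by (intro nn_integral_mono)
  with fin have "ennreal d * (\<integral>\<^sup>+y. ?G y \<partial>lebesgue) < top"
    by (simp add: nn_integral_cmult)
  then have G: "(\<integral>\<^sup>+y. ?G y \<partial>lebesgue) < top"
    using d by (auto simp: ennreal_mult_less_top)
  then have "ennreal (2 / s) * (\<integral>\<^sup>+y. ?G y \<partial>lebesgue) < top"
    by (simp add: ennreal_mult_less_top)
  then obtain R where R: "\<And>(x::'a) r. 0 < r \<Longrightarrow>
        emeasure lebesgue (ball x r) \<le> ennreal (2 / s) * (\<integral>\<^sup>+y. ?G y \<partial>lebesgue) \<Longrightarrow> r \<le> R"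
    using radius_le_of_emeasure_ball_le by blast
  have "(\<integral>\<^sup>+y\<in>ball x r. F y \<partial>lebesgue) \<le> ennreal s * emeasure lebesgue (ball x r)"
    if r: "max 0 R < r" for x r
  proof -
    \<comment> \<open>Contrapositive of the choice of \<open>R\<close>; the 0 in the maximum keeps r
      positive.\<close>
    have "ennreal (2 / s) * (\<integral>\<^sup>+y. ?G y \<partial>lebesgue) \<le> emeasure lebesgue (ball x r)"
      using R[of r x] r by (meson less_le_not_le max_less_iff_conj le_cases)
    then have "ennreal (s / 2) * (ennreal (2 / s) * (\<integral>\<^sup>+y. ?G y \<partial>lebesgue))
        \<le> ennreal (s / 2) * emeasure lebesgue (ball x r)"
      by (rule mult_left_mono) simp
    then have le: "(\<integral>\<^sup>+y. ?G y \<partial>lebesgue) \<le> ennreal (s / 2) * emeasure lebesgue (ball x r)"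
      using s by (simp add: mult.assoc[symmetric] ennreal_mult[symmetric])
    have "(\<integral>\<^sup>+y\<in>ball x r. F y \<partial>lebesgue)
        \<le> (\<integral>\<^sup>+y\<in>ball x r. ?G y \<partial>lebesgue) + ennreal (s / 2) * emeasure lebesgue (ball x r)"
      by (intro nn_integral_le_truncation) auto
    also have "\<dots> \<le> ennreal (s / 2) * emeasure lebesgue (ball x r) + ennreal (s / 2) * emeasure lebesgue (ball x r)"
      by (intro add_right_mono order_trans[OF _ le] nn_integral_mono) (auto simp: indicator_def)
    also have "\<dots> = ennreal s * emeasure lebesgue (ball x r)"
      using s by (simp add: distrib_right[symmetric] ennreal_plus[symmetric] del: ennreal_plus)
    finally show ?thesis .
  qed
  then show ?thesis by blast
qed

section \<open>Transfer to Orlicz spaces and Luxemburg norms\<close>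

lemma hl_maximal_eq: "hl_maximal f x = enn2ereal (maximal (\<lambda>y. e2ennreal \<bar>f y\<bar>) x)"
  by (simp add: hl_maximal_def maximal_def)

lemma e2ennreal_abs_hl_maximal:
  "e2ennreal \<bar>hl_maximal f x\<bar> = maximal (\<lambda>y. e2ennreal \<bar>f y\<bar>) x"
  by (simp add: hl_maximal_eq)

lemma borel_measurable_hl_maximal:
  assumes [measurable]: "f \<in> borel_measurable lebesgue"
  shows "hl_maximal f \<in> borel_measurable lebesgue"
proof -
  have [measurable]: "maximal (\<lambda>y. e2ennreal \<bar>f y\<bar>) \<in> borel_measurable lebesgue"
    by (intro borel_measurable_maximal) measurable
  show ?thesis unfolding hl_maximal_eq[abs_def] by measurable
qed

lemma hl_maximal_orlicz_space:
  assumes [measurable]: "a \<in> borel_measurable borel"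
    and f: "f \<in> orlicz_space (young_domain a)"
  shows "hl_maximal f \<in> orlicz_space (young_of a)"
proof -
  from f obtain l where [measurable]: "f \<in> borel_measurable lebesgue" and l: "0 < l"
    "(\<integral>\<^sup>+x. young_domain a (e2ennreal \<bar>f x\<bar> / ennreal l) \<partial>lebesgue) < \<infinity>"
    by (auto simp: orlicz_space_def)
  have "(\<integral>\<^sup>+x. young_of a (e2ennreal \<bar>hl_maximal f x\<bar> / ennreal (2 * l)) \<partial>lebesgue)
    \<le> 5 ^ DIM(real ^ 'a) * (\<integral>\<^sup>+x. young_domain a (e2ennreal \<bar>f x\<bar> / ennreal l) \<partial>lebesgue)"
    unfolding e2ennreal_abs_hl_maximal by (rule nn_integral_young_of_maximal_le[OF _ _ l(1)]) measurable
  also have "\<dots> < \<infinity>"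
    using l(2) by (simp add: ennreal_mult_less_top power_less_top_ennreal)
  finally show ?thesis
    using l(1) by (auto simp: orlicz_space_def borel_measurable_hl_maximal intro!: exI[of _ "2 * l"])
qed

text \<open>The argument treats each f separately. Membership in the space of b makes the means over
  large balls small, membership of the maximal function in the space of a makes the bounding modular
  finite; the scales \<open>k\<close> and \<open>l\<close> are unrelated.\<close>

lemma orlicz_space_subset_of_maximal:
  assumes [measurable]: "a \<in> borel_measurable borel" and b: "young_density b"
    and M: "hl_maximal ` (orlicz_space (young_of b) :: (real ^ 'n \<Rightarrow> ereal) set) \<subseteq> orlicz_space (young_of a)"
  shows "(orlicz_space (young_of b) :: (real ^ 'n \<Rightarrow> ereal) set) \<subseteq> orlicz_space (young_domain a)"
proof
  fix f :: "real ^ 'n \<Rightarrow> ereal" assume f: "f \<in> orlicz_space (young_of b)"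
  then obtain k where f_meas[measurable]: "f \<in> borel_measurable lebesgue" and k: "0 < k"
    "(\<integral>\<^sup>+x. young_of b (e2ennreal \<bar>f x\<bar> / ennreal k) \<partial>lebesgue) < \<infinity>"
    by (auto simp: orlicz_space_def)
  have "hl_maximal f \<in> orlicz_space (young_of a)" using M f by blast
  then obtain l where l: "0 < l"
    "(\<integral>\<^sup>+x. young_of a (maximal (\<lambda>y. e2ennreal \<bar>f y\<bar>) x / ennreal l) \<partial>lebesgue) < \<infinity>"
    by (auto simp: orlicz_space_def e2ennreal_abs_hl_maximal)
  let ?N = "DIM(real ^ 'n)"
  have "(\<integral>\<^sup>+x. young_domain a (e2ennreal \<bar>f x\<bar> / ennreal (2 ^ ?N * l)) \<partial>lebesgue)
    \<le> 5 ^ ?N * (\<integral>\<^sup>+x. young_of a (maximal (\<lambda>y. e2ennreal \<bar>f y\<bar>) x / ennreal l) \<partial>lebesgue)"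
    by (rule nn_integral_young_domain_le_maximal[OF _ _ l(1) ball_averages_small_of_young_of[OF b _ k]])
      measurable
  also have "\<dots> < \<infinity>"
    using l(2) by (simp add: ennreal_mult_less_top power_less_top_ennreal)
  finally show "f \<in> orlicz_space (young_domain a)"
    using l(1) f_meas unfolding orlicz_space_def
    by (intro CollectI conjI exI[of _ "2 ^ ?N * l"]) auto
qed

text \<open>The outer factor t yields 1/K, and the integral shrinks with its range. This absorbs the
  constant of a modular inequality into the scale of the norm.\<close>

lemma young_domain_scale_le:
  assumes "1 \<le> K" "0 < l"
  shows "young_domain a (t / ennreal (K * l)) \<le> ennreal (1 / K) * young_domain a (t / ennreal l)"
proof -
  have eq: "t / ennreal (K * l) = ennreal (1 / K) * (t / ennreal l)"
    using assms by (simp add: divide_ennreal_eq_mult mult.assoc[symmetric] ennreal_mult[symmetric])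
  have "t / ennreal (K * l) \<le> 1 * (t / ennreal l)"
    unfolding eq using assms by (intro mult_right_mono) auto
  then have "(\<integral>\<^sup>+s\<in>{s. 0 < s \<and> ennreal s < t / ennreal (K * l)}. ennreal (a s / s) \<partial>lborel)
      \<le> (\<integral>\<^sup>+s\<in>{s. 0 < s \<and> ennreal s < t / ennreal l}. ennreal (a s / s) \<partial>lborel)"
    by (intro nn_integral_mono) (auto simp: indicator_def)
  then show ?thesis
    unfolding young_domain_def mult.assoc[symmetric] eq[symmetric] by (rule mult_left_mono) simp
qed

text \<open>Dilating by a further K = 5^n gains 1/K, which cancels the 5^n of the modular
  inequality, so the unit bound in the definition of the norm is preserved.\<close>

lemma luxemburg_norm_hl_maximal_le:
  fixes f :: "real ^ 'n \<Rightarrow> ereal"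
  assumes [measurable]: "a \<in> borel_measurable borel" "f \<in> borel_measurable lebesgue"
  shows "luxemburg_norm (young_of a) (hl_maximal f)
    \<le> ennreal (2 * 5 ^ DIM(real ^ 'n)) * luxemburg_norm (young_domain a) f"
proof -
  define K :: real where "K = 5 ^ DIM(real ^ 'n)"
  have K: "1 \<le> K" "ennreal K = 5 ^ DIM(real ^ 'n)"
    by (auto simp: K_def one_le_power ennreal_power[symmetric])
  have *: "luxemburg_norm (young_of a) (hl_maximal f) \<le> ennreal (2 * K) * ennreal l"
    if l: "0 < l" and le1: "(\<integral>\<^sup>+x. young_domain a (e2ennreal \<bar>f x\<bar> / ennreal l) \<partial>lebesgue) \<le> 1" for l
  proof -
    have Kl: "0 < K * l" using K l by simp
    have "(\<integral>\<^sup>+x. young_of a (e2ennreal \<bar>hl_maximal f x\<bar> / ennreal (2 * (K * l))) \<partial>lebesgue)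
      \<le> ennreal K * (\<integral>\<^sup>+x. young_domain a (e2ennreal \<bar>f x\<bar> / ennreal (K * l)) \<partial>lebesgue)"
      unfolding e2ennreal_abs_hl_maximal K(2)
      by (rule nn_integral_young_of_maximal_le[OF _ _ Kl]) measurable
    also have "\<dots> \<le> ennreal K * (\<integral>\<^sup>+x. ennreal (1 / K) * young_domain a (e2ennreal \<bar>f x\<bar> / ennreal l) \<partial>lebesgue)"
      using K l by (intro mult_left_mono nn_integral_mono young_domain_scale_le) auto
    also have "\<dots> = ennreal K * (ennreal (1 / K) * (\<integral>\<^sup>+x. young_domain a (e2ennreal \<bar>f x\<bar> / ennreal l) \<partial>lebesgue))"
      unfolding young_domain_def divide_ennreal_def indicator_def
      by (subst nn_integral_cmult) auto
    also have "\<dots> = (\<integral>\<^sup>+x. young_domain a (e2ennreal \<bar>f x\<bar> / ennreal l) \<partial>lebesgue)"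
      using K(1) by (simp add: mult.assoc[symmetric] ennreal_mult[symmetric])
    also have "\<dots> \<le> 1" by (rule le1)
    finally have "luxemburg_norm (young_of a) (hl_maximal f) \<le> ennreal (2 * (K * l))"
      unfolding luxemburg_norm_def using Kl by (intro Inf_lower) auto
    then show ?thesis using K l by (simp add: ennreal_mult[symmetric] mult.assoc)
  qed
  \<comment> \<open>After division by 2 K the left side is a lower bound of all admissible scales,
    hence of their infimum, also when there are none.\<close>
  have "luxemburg_norm (young_of a) (hl_maximal f) / ennreal (2 * K) \<le> luxemburg_norm (young_domain a) f"
    unfolding luxemburg_norm_def[of "young_domain a"] using * K
    by (intro Inf_greatest) (auto intro!: divide_le_posI_ennreal)
  then have "ennreal (2 * K) * (luxemburg_norm (young_of a) (hl_maximal f) / ennreal (2 * K))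
      \<le> ennreal (2 * K) * luxemburg_norm (young_domain a) f"
    by (rule mult_left_mono) simp
  then show ?thesis
    using K by (simp add: divide_ennreal_eq_mult mult.assoc[symmetric] ennreal_mult[symmetric] K_def)
qed

section \<open>The domain Young function\<close>

text \<open>After exchanging the integrals, \<open>fin\<close> says that a(s) times the length of {t
  > 0 : k/(1+t) > s} is integrable, and this length is of order 1/s near 0. Away from 0,
  monotonicity bounds a(s)/s.\<close>

lemma young_domain_density_integrable:
  assumes a[measurable]: "a \<in> borel_measurable borel" and ya: "young_density a" and k: "0 < k"
    and fin: "(\<integral>\<^sup>+t\<in>{0<..}. young_of a (ennreal (k / (1 + t))) \<partial>lborel) < \<infinity>"
  shows "(\<integral>\<^sup>+s\<in>{s. 0 < s \<and> ennreal s < ennreal T}. ennreal (a s / s) \<partial>lborel) < \<infinity>"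
proof -
  have pos: "0 < a s" if "0 < s" for s
    using ya that by (auto simp: young_density_def)
  have mono: "a s \<le> a t" if "0 < s" "s \<le> t" for s t
    using ya that by (auto simp: young_density_def mono_on_def)
  let ?w = "\<lambda>t::real. indicator {0<..} t :: ennreal"
  have "(\<integral>\<^sup>+t\<in>{0<..}. young_of a (ennreal (k / (1 + t))) \<partial>lborel)
      = (\<integral>\<^sup>+t. ?w t * (\<integral>\<^sup>+s\<in>{s. 0 < s \<and> ennreal s < ennreal (k / (1 + t))}. ennreal (a s) \<partial>lborel) \<partial>lborel)"
    by (simp add: young_of_def mult.commute)
  also have "\<dots> = (\<integral>\<^sup>+s\<in>{0<..}. ennreal (a s) *
      (\<integral>\<^sup>+t\<in>{t. ennreal s < ennreal (k / (1 + t))}. ?w t \<partial>lborel) \<partial>lborel)"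
    by (rule nn_integral_layer_cake) (auto intro: sigma_finite_lborel)
  finally have fin': "(\<integral>\<^sup>+s\<in>{0<..}. ennreal (a s) *
      (\<integral>\<^sup>+t\<in>{t. ennreal s < ennreal (k / (1 + t))}. ?w t \<partial>lborel) \<partial>lborel) < \<infinity>"
    using fin by simp
  \<comment> \<open>For \<open>s < k\<close> the inner integral is \<open>k / s - 1\<close>, which is at least \<open>k / (2 s)\<close> when \<open>s \<le> k / 2\<close>.\<close>
  have near_0: "ennreal (a s) * (\<integral>\<^sup>+t\<in>{t. ennreal s < ennreal (k / (1 + t))}. ?w t \<partial>lborel)
      \<ge> ennreal (k / 2) * ennreal (a s / s)" if s: "0 < s" "s \<le> k / 2" for s
  proof -
    have "ennreal (k / (2 * s)) = (\<integral>\<^sup>+t. indicator {0<..<k / (2 * s)} t \<partial>lborel)"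
      using s k by simp
    also have "\<dots> \<le> (\<integral>\<^sup>+t\<in>{t. ennreal s < ennreal (k / (1 + t))}. ?w t \<partial>lborel)"
    proof (intro nn_integral_mono)
      fix t :: real
      have "s < k / (1 + t)" if "0 < t" "t < k / (2 * s)"
      proof -
        have "t * (2 * s) < k" using that(2) s(1) by (simp add: field_simps)
        then have "s * (1 + t) < k" using s by (simp add: algebra_simps)
        then show ?thesis using that(1) by (simp add: field_simps)
      qed
      then show "indicator {0<..<k / (2 * s)} t \<le> ?w t * indicator {t. ennreal s < ennreal (k / (1 + t))} t"
        using s by (auto simp: indicator_def ennreal_less_iff)
    qed
    finally have "ennreal (a s) * ennreal (k / (2 * s))
        \<le> ennreal (a s) * (\<integral>\<^sup>+t\<in>{t. ennreal s < ennreal (k / (1 + t))}. ?w t \<partial>lborel)"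
      by (rule mult_left_mono) simp
    also have "ennreal (a s) * ennreal (k / (2 * s)) = ennreal (k / 2) * ennreal (a s / s)"
      using s k pos[OF s(1)] by (simp add: ennreal_mult[symmetric] mult.commute)
    finally show ?thesis .
  qed
  have "ennreal (k / 2) * (\<integral>\<^sup>+s\<in>{0<..k / 2}. ennreal (a s / s) \<partial>lborel)
      = (\<integral>\<^sup>+s. ennreal (k / 2) * (ennreal (a s / s) * indicator {0<..k / 2} s) \<partial>lborel)"
    by (rule nn_integral_cmult[symmetric]) measurable
  also have "\<dots> \<le> (\<integral>\<^sup>+s\<in>{0<..}. ennreal (a s) *
      (\<integral>\<^sup>+t\<in>{t. ennreal s < ennreal (k / (1 + t))}. ?w t \<partial>lborel) \<partial>lborel)"
    using near_0 by (intro nn_integral_mono) (auto simp: indicator_def)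
  finally have "ennreal (k / 2) * (\<integral>\<^sup>+s\<in>{0<..k / 2}. ennreal (a s / s) \<partial>lborel) < \<infinity>"
    using fin' by (rule le_less_trans)
  then have fin0: "(\<integral>\<^sup>+s\<in>{0<..k / 2}. ennreal (a s / s) \<partial>lborel) < \<infinity>"
    using k by (auto simp: ennreal_mult_less_top)
  have far: "(\<integral>\<^sup>+s\<in>{k / 2<..<T}. ennreal (a s / s) \<partial>lborel) < \<infinity>"
  proof -
    have "(\<integral>\<^sup>+s\<in>{k / 2<..<T}. ennreal (a s / s) \<partial>lborel)
        \<le> (\<integral>\<^sup>+s. ennreal (a T / (k / 2)) * indicator {k / 2<..<T} s \<partial>lborel)"
    proof (intro nn_integral_mono)
      fix s :: real
      have "a s / s \<le> a T / (k / 2)" if "k / 2 < s" "s < T"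
        using that k mono[of s T] pos[of T] by (intro frac_le) auto
      then show "ennreal (a s / s) * indicator {k / 2<..<T} s \<le> ennreal (a T / (k / 2)) * indicator {k / 2<..<T} s"
        by (auto simp: indicator_def intro: ennreal_leI)
    qed
    also have "\<dots> < \<infinity>"
      by (cases "k / 2 \<le> T") (simp_all add: nn_integral_cmult_indicator ennreal_mult_less_top)
    finally show ?thesis .
  qed
  have "(\<integral>\<^sup>+s\<in>{s. 0 < s \<and> ennreal s < ennreal T}. ennreal (a s / s) \<partial>lborel)
      \<le> (\<integral>\<^sup>+s. ennreal (a s / s) * indicator {0<..k / 2} s + ennreal (a s / s) * indicator {k / 2<..<T} s \<partial>lborel)"
    by (intro nn_integral_mono) (auto simp: indicator_def ennreal_less_iff)
  also have "\<dots> < \<infinity>"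
    using fin0 far by (subst nn_integral_add) auto
  finally show ?thesis .
qed

text \<open>
  The density of \<open>\<A>\<close> is \<open>a(u) + \<integral>\<^bsub>0\<^esub>\<^bsup>u\<^esup> a(s) / s ds\<close>, the derivative of \<open>u \<integral>\<^bsub>0\<^esub>\<^bsup>u\<^esup> a(s) / s ds\<close>.
\<close>

lemma young_domain_eq_young_of:
  assumes [measurable]: "a \<in> borel_measurable borel"
    and b: "\<And>u. 0 < u \<Longrightarrow>
      ennreal (b u) = ennreal (a u) + (\<integral>\<^sup>+s\<in>{s. 0 < s \<and> ennreal s < ennreal u}. ennreal (a s / s) \<partial>lborel)"
  shows "young_domain a = young_of b"
proof
  fix t :: ennreal
  let ?I = "\<lambda>u. \<integral>\<^sup>+s\<in>{s. 0 < s \<and> ennreal s < ennreal u}. ennreal (a s / s) \<partial>lborel"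
  let ?w = "indicator {u. 0 < u \<and> ennreal u < t} :: real \<Rightarrow> ennreal"
  have [measurable]: "?I \<in> borel_measurable borel"
    unfolding indicator_def by measurable
  have [measurable]: "?w \<in> borel_measurable borel"
    unfolding indicator_def by measurable
  have inner: "(\<integral>\<^sup>+u\<in>{u. ennreal s < ennreal u}. ?w u \<partial>lborel) = t - ennreal s" if "0 < s" for s
  proof -
    have "(\<integral>\<^sup>+u\<in>{u. ennreal s < ennreal u}. ?w u \<partial>lborel)
        = (\<integral>\<^sup>+u. indicator {u. s < u \<and> ennreal u < t} u \<partial>lborel)"
      using that by (intro nn_integral_cong) (auto simp: indicator_def ennreal_less_iff)
    also have "\<dots> = emeasure lborel {u. s < u \<and> ennreal u < t}"
      by (rule nn_integral_indicator) measurable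
    also have "\<dots> = t - ennreal s"
      using that by (simp add: emeasure_lborel_greater_ennreal_less)
    finally show ?thesis .
  qed
  have "young_of b t = (\<integral>\<^sup>+u. ennreal (a u) * ?w u + ?w u * ?I u \<partial>lborel)"
    unfolding young_of_def using b
    by (intro nn_integral_cong) (auto simp: indicator_def)
  also have "\<dots> = (\<integral>\<^sup>+u. ennreal (a u) * ?w u \<partial>lborel) + (\<integral>\<^sup>+u. ?w u * ?I u \<partial>lborel)"
    by (rule nn_integral_add) measurable
  \<comment> \<open>Exchange of u and s: the weight cuts u off at t, so the range u > s has length t
    - s.\<close>
  also have "(\<integral>\<^sup>+u. ?w u * ?I u \<partial>lborel)
      = (\<integral>\<^sup>+s\<in>{0<..}. ennreal (a s / s) * (\<integral>\<^sup>+u\<in>{u. ennreal s < ennreal u}. ?w u \<partial>lborel) \<partial>lborel)"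
    by (rule nn_integral_layer_cake[OF sigma_finite_lborel]) measurable
  also have "\<dots> = (\<integral>\<^sup>+s\<in>{0<..}. ennreal (a s / s) * (t - ennreal s) \<partial>lborel)"
    using inner by (intro nn_integral_cong) (auto simp: indicator_def)
  also have "(\<integral>\<^sup>+u. ennreal (a u) * ?w u \<partial>lborel) + (\<integral>\<^sup>+s\<in>{0<..}. ennreal (a s / s) * (t - ennreal s) \<partial>lborel)
      = (\<integral>\<^sup>+s. ennreal (a s) * ?w s + ennreal (a s / s) * (t - ennreal s) * indicator {0<..} s \<partial>lborel)"
    by (rule nn_integral_add[symmetric]) measurable
  \<comment> \<open>For 0 < s < t the sum is a(s)/s times s + (t - s). For s \<ge> t both terms
    vanish, since subtraction is truncated.\<close>
  also have "\<dots> = (\<integral>\<^sup>+s. t * (ennreal (a s / s) * ?w s) \<partial>lborel)"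
  proof (intro nn_integral_cong)
    fix s :: real
    show "ennreal (a s) * ?w s + ennreal (a s / s) * (t - ennreal s) * indicator {0<..} s = t * (ennreal (a s / s) * ?w s)"
    proof (cases "0 < s \<and> ennreal s < t")
      case True
      have "ennreal (a s) = ennreal (a s / s) * ennreal s"
        using True by (simp add: ennreal_mult''[symmetric])
      then have "ennreal (a s) + ennreal (a s / s) * (t - ennreal s) = ennreal (a s / s) * (t - ennreal s + ennreal s)"
        by (simp add: distrib_left add.commute)
      also have "t - ennreal s + ennreal s = t"
        using True by (intro diff_add_cancel_ennreal) auto
      finally show ?thesis using True by (simp add: mult.commute)
    qed (auto simp: indicator_def not_less intro!: diff_eq_0_ennreal intro: le_less_trans)
  qed
  also have "\<dots> = young_domain a t"
    unfolding young_domain_def by (rule nn_integral_cmult) measurable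
  finally show "young_domain a t = young_of b t" by (rule sym)
qed

text \<open>The density is a + J with J the indefinite integral of a(s)/s. As a monotone function
  onto an open set, a is continuous; J is continuous and vanishes at 0, so the intermediate value
  theorem shows that the density is onto.\<close>

lemma young_function_young_domain:
  assumes a[measurable]: "a \<in> borel_measurable borel" and ya: "young_density a"
    and fin: "\<And>T. (\<integral>\<^sup>+s\<in>{s. 0 < s \<and> ennreal s < ennreal T}. ennreal (a s / s) \<partial>lborel) < \<infinity>"
  shows "young_function (young_domain a)"
proof -
  have pos: "0 < a s" if "0 < s" for s
    using ya that by (auto simp: young_density_def)
  have mono: "a s \<le> a t" if "0 < s" "s \<le> t" for s t
    using ya that by (auto simp: young_density_def mono_on_def)
  have surj: "\<exists>s>0. a s = y" if "0 < y" for y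
  proof -
    have "y \<in> a ` {0<..}" using ya that by (simp add: young_density_def)
    then show ?thesis by auto
  qed
  have cont_a: "continuous_on {0<..} a"
    using ya by (intro continuous_onI_mono) (auto simp: young_density_def mono_on_def)
  let ?I = "\<lambda>t. \<integral>\<^sup>+s\<in>{s. 0 < s \<and> ennreal s < ennreal t}. ennreal (a s / s) \<partial>lborel"
  \<comment> \<open>Extension by 0 allows integration over the closed interval from 0 to t; the
    endpoint t, excluded from the range in \<open>?I\<close>, is null.\<close>
  define h where "h s = (if 0 < s then a s / s else 0)" for s
  have h[measurable]: "h \<in> borel_measurable borel" unfolding h_def by measurable
  have h_nonneg: "0 \<le> h s" for s using pos[of s] by (cases "0 < s") (simp_all add: h_def)
  define J where "J t = integral {0..t} h" for t
  have set_eq: "(\<integral>\<^sup>+s. ennreal (h s * indicator {0..t} s) \<partial>lborel) = ?I t" for t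
    using AE_lborel_singleton[of t]
    by (intro nn_integral_cong_AE, eventually_elim)
      (auto simp: h_def indicator_def ennreal_less_iff)
  have restrict: "(\<lambda>s. h s * indicator {0..t} s) = (\<lambda>s. if s \<in> {0..t} then h s else 0)" for t
    by (auto simp: indicator_def)
  have int: "h integrable_on {0..t}" for t
  proof -
    have "(\<lambda>s. h s * indicator {0..t} s) integrable_on UNIV"
      by (rule nn_integral_integrable_on) (use fin[of t] in \<open>auto simp: set_eq h_nonneg\<close>)
    then show ?thesis unfolding restrict integrable_restrict_UNIV .
  qed
  have J: "ennreal (J t) = ?I t" for t
  proof -
    have "?I t = integral UNIV (\<lambda>s. h s * indicator {0..t} s)"
      unfolding set_eq[symmetric]
      by (rule nn_integral_lborel_eq_integral) (use fin[of t] in \<open>auto simp: set_eq h_nonneg\<close>)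
    then show ?thesis unfolding restrict integral_restrict_UNIV J_def by simp
  qed
  have J_nonneg: "0 \<le> J t" for t
    unfolding J_def by (rule integral_nonneg[OF int h_nonneg])
  have J_mono: "J s \<le> J t" if "s \<le> t" for s t
    unfolding J_def using that by (intro integral_subset_le int) (auto simp: h_nonneg)
  have cont_J: "continuous_on {0..T} J" for T
    unfolding J_def by (rule indefinite_integral_continuous_1[OF int])
  define b where "b t = a t + J t" for t
  have "young_density b"
    unfolding young_density_def
  proof
    show "mono_on {0<..} b"
      by (auto simp: mono_on_def b_def intro!: add_mono mono J_mono)
    show "b ` {0<..} = {0<..}"
    proof (intro equalityI subsetI)
      fix y assume "y \<in> b ` {0<..}"
      then show "y \<in> {0<..}" using pos J_nonneg by (auto simp: b_def add_pos_nonneg)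
    next
      fix y :: real assume "y \<in> {0<..}"
      then have y: "0 < y" by simp
      \<comment> \<open>At \<open>s2\<close> the summand a alone reaches y. Close to 0, and not
        beyond \<open>s1\<close>, both a and J are at most y/2, so the density is at most y
        there.\<close>
      obtain s1 where s1: "0 < s1" "a s1 = y / 2" using surj[of "y / 2"] y by auto
      obtain s2 where s2: "0 < s2" "a s2 = y" using surj[of y] y by auto
      have "(J \<longlongrightarrow> J 0) (at 0 within {0..1})"
        using cont_J[of 1] by (auto simp: continuous_on_def)
      moreover have "J 0 = 0" by (simp add: J_def)
      ultimately have "\<forall>\<^sub>F t in at 0 within {0..1}. J t < y / 2"
        using y by (intro order_tendstoD) auto
      then obtain d where d: "0 < d" "\<And>t. t \<in> {0..1} \<Longrightarrow> t \<noteq> 0 \<Longrightarrow> dist t 0 < d \<Longrightarrow> J t < y / 2"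
        by (auto simp: eventually_at)
      define t1 where "t1 = min s1 (min s2 (min 1 (d / 2)))"
      have t1: "0 < t1" "t1 \<le> s1" "t1 \<le> s2" "t1 \<le> 1" "t1 < d"
        using s1 s2 d by (auto simp: t1_def)
      have "J t1 < y / 2" using t1 by (intro d(2)) auto
      moreover have "a t1 \<le> y / 2" using mono[OF t1(1,2)] s1 by simp
      ultimately have "b t1 \<le> y" by (simp add: b_def)
      moreover have "y \<le> b s2" using s2 J_nonneg[of s2] by (simp add: b_def)
      moreover have "continuous_on {t1..s2} b"
        unfolding b_def using t1(1)
        by (intro continuous_on_add continuous_on_subset[OF cont_a] continuous_on_subset[OF cont_J[of s2]]) auto
      ultimately obtain t where "t1 \<le> t" "b t = y"
        using IVT'[of b t1 y s2] t1(3) by blast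
      then show "y \<in> b ` {0<..}" using t1(1) by (intro image_eqI[of _ _ t]) auto
    qed
  qed
  moreover have "young_domain a = young_of b"
  proof (rule young_domain_eq_young_of[OF a])
    show "ennreal (b u) = ennreal (a u) + ?I u" if "0 < u" for u
      using that pos[of u] J_nonneg[of u] by (simp add: b_def J[symmetric])
  qed
  ultimately show ?thesis by (auto simp: young_function_def)
qed

text \<open>
  The values of \<open>a\<close> on \<open>(-\<infinity>, 0]\<close> are arbitrary, so \<open>a\<close> itself need not be measurable.
\<close>

lemma young_density_measurable_version:
  assumes "young_density a"
  obtains a' where "a' \<in> borel_measurable borel" "young_density a'"
    "young_of a = young_of a'" "young_domain a = young_domain a'"
proof
  let ?a = "\<lambda>s. if 0 < s then a s else 0"
  have "0 < a s" if "0 < s" for s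
    using assms that by (auto simp: young_density_def)
  then have "0 \<le> a s" if "0 < s" for s
    using that less_imp_le by blast
  then have "mono ?a"
    using assms by (auto simp: mono_def young_density_def mono_on_def)
  then show "?a \<in> borel_measurable borel" by (rule borel_measurable_mono)
  have "?a ` {0<..} = a ` {0<..}" by (intro image_cong) auto
  then show "young_density ?a"
    using assms by (simp add: young_density_def mono_on_def)
  show "young_of a = young_of ?a"
    unfolding young_of_def by (intro ext nn_integral_cong) (simp add: indicator_def)
  show "young_domain a = young_domain ?a"
    unfolding young_domain_def
    by (rule ext, rule arg_cong2[where f = "(*)"], rule refl, rule nn_integral_cong) (simp add: indicator_def)
qed

theorem theorem4p2:
  fixes a :: "real \<Rightarrow> real" and A \<A> :: "ennreal \<Rightarrow> ennreal" and k :: real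
  assumes "young_density a"
    and "A = young_of a"
    and "k > 0"
    and "(\<integral>\<^sup>+t\<in>{0<..}. A (ennreal (k / (1 + t))) \<partial>lborel) < \<infinity>"
    and "\<A> = young_domain a"
  shows "young_function \<A> \<and>
    (\<exists>C>0. \<forall>f :: real ^ 'n \<Rightarrow> ereal. locally_integrable f \<longrightarrow>
       luxemburg_norm A (hl_maximal f) \<le> ennreal C * luxemburg_norm \<A> f) \<and>
    hl_maximal ` (orlicz_space \<A> :: (real ^ 'n \<Rightarrow> ereal) set) \<subseteq> orlicz_space A \<and>
    (\<forall>B. young_function B \<longrightarrow>
       hl_maximal ` (orlicz_space B :: (real ^ 'n \<Rightarrow> ereal) set) \<subseteq> orlicz_space A \<longrightarrow>
       (orlicz_space B :: (real ^ 'n \<Rightarrow> ereal) set) \<subseteq> orlicz_space \<A>)"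
proof -
  \<comment> \<open>Passing to a Borel version of the density changes neither Young function and
    makes the modular inequalities applicable.\<close>
  obtain a' where a': "a' \<in> borel_measurable borel" "young_density a'"
    and A: "A = young_of a'" and \<A>: "\<A> = young_domain a'"
    using young_density_measurable_version[OF assms(1)] assms(2,5) by metis
  have "young_function \<A>"
    unfolding \<A> using assms(3,4)
    by (intro young_function_young_domain young_domain_density_integrable[OF a'] a') (simp_all add: A)
  moreover have "luxemburg_norm A (hl_maximal f) \<le> ennreal (2 * 5 ^ DIM(real ^ 'n)) * luxemburg_norm \<A> f"
    if "locally_integrable f" for f :: "real ^ 'n \<Rightarrow> ereal"
    unfolding A \<A> using that by (intro luxemburg_norm_hl_maximal_le a') (simp add: locally_integrable_def)
  moreover have "hl_maximal ` (orlicz_space \<A> :: (real ^ 'n \<Rightarrow> ereal) set) \<subseteq> orlicz_space A"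
    unfolding A \<A> using hl_maximal_orlicz_space[OF a'(1)] by blast
  moreover have "(orlicz_space B :: (real ^ 'n \<Rightarrow> ereal) set) \<subseteq> orlicz_space \<A>"
    if "young_function B" "hl_maximal ` (orlicz_space B :: (real ^ 'n \<Rightarrow> ereal) set) \<subseteq> orlicz_space A" for B
    using that orlicz_space_subset_of_maximal[OF a'(1)] unfolding A \<A> young_function_def by metis
  ultimately show ?thesis
    by (intro conjI exI[of _ "2 * 5 ^ DIM(real ^ 'n)"]) auto
qed

end
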